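(* Consider the deterministic ZS network with non-negative integer channel gains $m_{11}, m_{12}, m_{22}$ (first stage) and $n_{11}, n_{21}, n_{22}$ (second stage), the gains $m_{21}$ and $n_{12}$ being zero. The admissible rate region of this network is the set of all pairs $(r_1,r_2)$ of non-negative real numbers which satisfy $$r_1 \le m_{11},$$ $$r_1 \le n_{11},$$ $$r_2 \le \max(m_{12}, m_{22}),$$ $$r_2 \le \max(n_{21}, n_{22}),$$ $$r_2 \le m_{12} + n_{22},$$ $$r_2 \le m_{22} + n_{21},$$ $$r_1 + r_2 \le \max(m_{11}, m_{12}) + n_{22},$$ $$r_1 + r_2 \le m_{22} + \max(n_{11}, n_{21}),$$ $$r_1 + r_2 \le \max(m_{11}, m_{12}) + (m_{22}-m_{12})^+,$$ $$r_1 + r_2 \le \max(n_{21}, n_{22}) + (n_{11}-n_{21})^+.$$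
   Context: Notation: $(x)^+ = \max(x,0)$. All signal arithmetic is over the binary field $\mathbb{F}_2$. Two-stage deterministic network. There are two sources $S_1,S_2$, two relays $R_1,R_2$ and two destinations $D_1,D_2$. Let $m_{ij}$ (gain from $S_j$ to $R_i$) and $n_{ij}$ (gain from $R_j$ to $D_i$), $i,j\in\{1,2\}$, be non-negative integers, and let $q\ge 1$ be an integer at least as large as all of them. Let $J$ be the $q\times q$ shift matrix over $\mathbb{F}_2$ with ones exactly on the first subdiagonal (entry $(k+1,k)$ equal to $1$ for $1\le k\le q-1$) and zeros elsewhere, with $J^0=I$. Put $M_{ij}=J^{q-m_{ij}}$ and $N_{ij}=J^{q-n_{ij}}$ (so a link of gain $0$ has the zero matrix). At each time instant, if the sources send $X_1,X_2\in\mathbb{F}_2^q$, the relays receive $$Y_1' = M_{11}X_1+M_{12}X_2,\qquad Y_2' = M_{21}X_1+M_{22}X_2,$$ and if the relays send $X_1',X_2'\in\mathbb{F}_2^q$, the destinations receive $$Y_1 = N_{11}X_1'+N_{12}X_2',\qquad Y_2 = N_{21}X_1'+N_{22}X_2'.$$ Only the relays hear the sources, and only the destinations hear the relays. ZS network: the case $m_{21}=0$ (no link from $S_1$ to $R_2$) and $n_{12}=0$ (no link from $R_2$ to $D_1$). Codes. Sources $S_1, S_2$ have independent messages $W_1,W_2$, uniformly distributed on finite sets $\mathcal{W}_1,\mathcal{W}_2$. A code of block length $n$ consists of: source encoders $\mathcal{W}_i\to(\mathbb{F}_2^q)^n$, $W_i\mapsto X_i^n$ ($i=1,2$), used over a block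 of $n$ time instants; relay maps $(\mathbb{F}_2^q)^n\to(\mathbb{F}_2^q)^n$, $Y_i'^n\mapsto X_i'^n$ ($i=1,2$), each relay waiting for the whole received block and then sending the resulting vectors in the next block of $n$ time instants; and decoders $(\mathbb{F}_2^q)^n\to\mathcal{W}_i$, $Y_i^n\mapsto\hat W_i$ ($i=1,2$), where $D_i$ is only required to decode $W_i$. The error probability is $\Pr[(\hat W_1,\hat W_2)\neq(W_1,W_2)]$. Admissible rates. A pair $(r_1,r_2)$ of non-negative reals is admissible if for every $\varepsilon>0$ and all sufficiently large $n$ there is a code of block length $n$ with $|\mathcal{W}_i|\ge 2^{n(r_i-\varepsilon)}$ for $i=1,2$ and error probability at most $\varepsilon$. The admissible rate region (capacity region) is the set of all admissible pairs. *)

theory Defs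
  imports
    "HOL-Library.Z2"
    "HOL-Probability.Probability_Mass_Function"
    "Jordan_Normal_Form.Matrix"
begin

text \<open>
  Nodes and users are indexed by 1 and 2. A gain table \<open>g\<close> assigns to \<open>g i j\<close> the gain of the link
  from transmitter \<open>j\<close> to receiver \<open>i\<close>; only the indices 1 and 2 matter. The binary field is
  the type \<open>bit\<close>.
\<close>

definition shift_mat :: "nat \<Rightarrow> bit mat" where
  "shift_mat q = mat q q (\<lambda>(k, l). if k = Suc l then 1 else 0)"

definition link_mat :: "nat \<Rightarrow> nat \<Rightarrow> bit mat" where
  "link_mat q g = shift_mat q ^\<^sub>m (q - g)"

definition received :: "nat \<Rightarrow> (nat \<Rightarrow> nat \<Rightarrow> nat) \<Rightarrow> nat \<Rightarrow> bit vec \<Rightarrow> bit vec \<Rightarrow> bit vec" where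
  "received q g i x1 x2 = link_mat q (g i 1) *\<^sub>v x1 + link_mat q (g i 2) *\<^sub>v x2"

definition blocks :: "nat \<Rightarrow> nat \<Rightarrow> bit vec list set" where
  "blocks q k = {xs. length xs = k \<and> set xs \<subseteq> carrier_vec q}"

definition received_block ::
  "nat \<Rightarrow> (nat \<Rightarrow> nat \<Rightarrow> nat) \<Rightarrow> nat \<Rightarrow> bit vec list \<Rightarrow> bit vec list \<Rightarrow> bit vec list" where
  "received_block q g i xs1 xs2 = map2 (received q g i) xs1 xs2"

text \<open>Message sets are finite sets of natural numbers; only their cardinalities matter.\<close>

record two_stage_code =
  messages :: "nat \<Rightarrow> nat set"
  encoder :: "nat \<Rightarrow> nat \<Rightarrow> bit vec list"
  relay_map :: "nat \<Rightarrow> bit vec list \<Rightarrow> bit vec list"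
  decoder :: "nat \<Rightarrow> bit vec list \<Rightarrow> nat"

definition is_code :: "nat \<Rightarrow> nat \<Rightarrow> two_stage_code \<Rightarrow> bool" where
  "is_code q k c \<longleftrightarrow> (\<forall>i\<in>{1, 2}.
     finite (messages c i) \<and> messages c i \<noteq> {} \<and>
     encoder c i \<in> messages c i \<rightarrow> blocks q k \<and>
     relay_map c i \<in> blocks q k \<rightarrow> blocks q k \<and>
     decoder c i \<in> blocks q k \<rightarrow> messages c i)"

definition relay_block ::
  "nat \<Rightarrow> (nat \<Rightarrow> nat \<Rightarrow> nat) \<Rightarrow> two_stage_code \<Rightarrow> nat \<Rightarrow> nat \<times> nat \<Rightarrow> bit vec list" where
  "relay_block q m c i w =
     relay_map c i (received_block q m i (encoder c 1 (fst w)) (encoder c 2 (snd w)))"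

definition decoded ::
  "nat \<Rightarrow> (nat \<Rightarrow> nat \<Rightarrow> nat) \<Rightarrow> (nat \<Rightarrow> nat \<Rightarrow> nat) \<Rightarrow> two_stage_code \<Rightarrow> nat \<Rightarrow> nat \<times> nat \<Rightarrow> nat" where
  "decoded q m n c i w =
     decoder c i (received_block q n i (relay_block q m c 1 w) (relay_block q m c 2 w))"

definition error_prob ::
  "nat \<Rightarrow> (nat \<Rightarrow> nat \<Rightarrow> nat) \<Rightarrow> (nat \<Rightarrow> nat \<Rightarrow> nat) \<Rightarrow> two_stage_code \<Rightarrow> real" where
  "error_prob q m n c =
     measure_pmf.prob (pair_pmf (pmf_of_set (messages c 1)) (pmf_of_set (messages c 2)))
       {w. (decoded q m n c 1 w, decoded q m n c 2 w) \<noteq> w}"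

definition admissible ::
  "nat \<Rightarrow> (nat \<Rightarrow> nat \<Rightarrow> nat) \<Rightarrow> (nat \<Rightarrow> nat \<Rightarrow> nat) \<Rightarrow> real \<Rightarrow> real \<Rightarrow> bool" where
  "admissible q m n r1 r2 \<longleftrightarrow> 0 \<le> r1 \<and> 0 \<le> r2 \<and>
     (\<forall>\<epsilon>>0. \<forall>\<^sub>F k in sequentially. \<exists>c. is_code q k c \<and>
        real (card (messages c 1)) \<ge> 2 powr (real k * (r1 - \<epsilon>)) \<and>
        real (card (messages c 2)) \<ge> 2 powr (real k * (r2 - \<epsilon>)) \<and>
        error_prob q m n c \<le> \<epsilon>)"

definition admissible_region ::
  "nat \<Rightarrow> (nat \<Rightarrow> nat \<Rightarrow> nat) \<Rightarrow> (nat \<Rightarrow> nat \<Rightarrow> nat) \<Rightarrow> (real \<times> real) set" where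
  "admissible_region q m n = {(r1, r2). admissible q m n r1 r2}"

end

theory Submission
  imports Defs
begin

text \<open>Over \<open>k\<close> uses the network is again a shift network, with all gains multiplied by \<open>k\<close>, so it
  suffices to treat integer rate pairs and single uses.

  \<^emph>\<open>Converse.\<close> For each bound, the pairs of messages that are decoded correctly are determined by
  the stated number of bits observed at a cut. No entropy is needed: this is a count of correctly
  decoded pairs. The last two bounds use that the first relay can decode the first message (the
  first destination hears nothing else) and that the second destination, knowing the second message,
  knows the output of the second relay; each of them can therefore strip off one of the signals it
  hears.

  \<^emph>\<open>Achievability.\<close> Plain routing of uncoded bits suffices. The second message is split into \<open>k1\<close>
  bits that travel through the first relay and \<open>k2\<close> bits that travel through the second one. In
  either stage, the bits can be put on levels where they do not collide at the receiver that needs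
  them; the conditions for this, which are the same for both stages, follow from the ten bounds for
  a suitable \<open>k1\<close>.\<close>

unbundle no vec_syntax
declare One_nat_def [simp del]

subsection \<open>Blocks as single uses of a larger shift network\<close>

lemma shift_mat_pow:
  "shift_mat q ^\<^sub>m j = mat q q (\<lambda>(k, l). if k = l + j then 1 else 0)"
proof (induction j)
  case 0
  show ?case
    by (rule eq_matI) (auto simp: shift_mat_def)
next
  case (Suc j)
  have "mat q q (\<lambda>(k, l). if k = l + j then 1 else (0::bit)) * shift_mat q =
      mat q q (\<lambda>(k, l). if k = l + Suc j then 1 else 0)"
  proof (rule eq_matI)
    fix k l
    assume "k < dim_row (mat q q (\<lambda>(k, l). if k = l + Suc j then 1 else (0::bit)))"
      and "l < dim_col (mat q q (\<lambda>(k, l). if k = l + Suc j then 1 else (0::bit)))"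
    then have kl: "k < q" "l < q"
      by auto
    have "(mat q q (\<lambda>(k, l). if k = l + j then 1 else (0::bit)) * shift_mat q) $$ (k, l) =
        (\<Sum>i\<in>{0..<q}. (if k = i + j then 1 else 0) * (if i = Suc l then 1 else 0))"
      using kl by (auto simp: shift_mat_def scalar_prod_def intro!: sum.cong)
    also have "\<dots> = (\<Sum>i\<in>{0..<q}. if i = Suc l then (if k = Suc l + j then 1 else 0) else 0)"
      by (rule sum.cong) auto
    also have "\<dots> = (if k = l + Suc j then 1 else 0)"
      using kl by auto
    finally show "(mat q q (\<lambda>(k, l). if k = l + j then 1 else (0::bit)) * shift_mat q) $$ (k, l) =
        mat q q (\<lambda>(k, l). if k = l + Suc j then 1 else 0) $$ (k, l)"
      using kl by auto
  qed (auto simp: shift_mat_def)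
  then show ?case
    using Suc.IH by simp
qed

text \<open>Index 0 is the most significant level. The link pushes the signal down by
  \<open>q - g\<close> levels, so for \<open>g \<le> q\<close> only entries with index below
  \<open>g\<close> survive, and for \<open>g = 0\<close> none, because \<open>l < q\<close>.\<close>

lemma link_mat_mult_vec:
  assumes "x \<in> carrier_vec q" "l < q"
  shows "(link_mat q g *\<^sub>v x) $ l = (if q - g \<le> l then x $ (l - (q - g)) else 0)"
proof -
  have "(link_mat q g *\<^sub>v x) $ l = (\<Sum>i\<in>{0..<q}. (if l = i + (q - g) then 1 else 0) * x $ i)"
    using assms by (auto simp: link_mat_def shift_mat_pow scalar_prod_def intro!: sum.cong)
  \<comment> \<open>The index solving \<open>l = i + (q - g)\<close> is \<open>l - (q - g)\<close>.
    The inner conditional covers \<open>l < q - g\<close>, where truncated subtraction would wrongly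
    point to index 0.\<close>
  also have "\<dots> = (\<Sum>i\<in>{0..<q}. if i = l - (q - g) then (if q - g \<le> l then x $ (l - (q - g)) else 0) else 0)"
    by (rule sum.cong) auto
  also have "\<dots> = (if q - g \<le> l then x $ (l - (q - g)) else 0)"
    using assms by auto
  finally show ?thesis .
qed

text \<open>Interleaving the uses of a block, level by level, turns \<open>k\<close> uses of a link of gain \<open>g\<close>
  into a single use of a link of gain \<open>k * g\<close>.\<close>

definition level_bit :: "nat \<Rightarrow> bit vec list \<Rightarrow> nat \<Rightarrow> bit" where
  "level_bit k xs p = (xs ! (p mod k)) $ (p div k)"

text \<open>Inverse of the interleaving. Positions are ordered by level first and by time within a
  level, so the top \<open>g\<close> levels of all \<open>k\<close> vectors form the initial segment
  below \<open>k * g\<close>.\<close>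

definition of_levels :: "nat \<Rightarrow> nat \<Rightarrow> (nat \<Rightarrow> bit) \<Rightarrow> bit vec list" where
  "of_levels q k x = map (\<lambda>t. vec q (\<lambda>l. x (l * k + t))) [0..<k]"

definition delay :: "nat \<Rightarrow> (nat \<Rightarrow> bit) \<Rightarrow> nat \<Rightarrow> bit" where
  "delay s x p = (if s \<le> p then x (p - s) else 0)"

lemma div_less_of_less_mult: "p < k * q \<Longrightarrow> p div k < (q::nat)"
  by (simp add: less_mult_imp_div_less mult.commute)

lemma of_levels_in_blocks [simp]: "of_levels q k x \<in> blocks q k"
  by (auto simp: of_levels_def blocks_def)

lemma level_bit_of_levels [simp]:
  assumes "p < k * q"
  shows "level_bit k (of_levels q k x) p = x p"
proof -
  have "k > 0"
    using assms by (cases k) auto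
  then show ?thesis
    using div_less_of_less_mult[OF assms] by (simp add: level_bit_def of_levels_def)
qed

lemma received_carrier [simp]: "received q g i x y \<in> carrier_vec q"
  by (rule carrier_vecI) (simp add: received_def link_mat_def shift_mat_pow)

lemma received_block_in_blocks:
  assumes "xs \<in> blocks q k" "ys \<in> blocks q k"
  shows "received_block q g i xs ys \<in> blocks q k"
proof -
  have "length (received_block q g i xs ys) = k"
    using assms by (simp add: blocks_def received_block_def)
  moreover have "set (received_block q g i xs ys) \<subseteq> carrier_vec q"
    unfolding received_block_def by (simp add: image_subset_iff split_beta)
  ultimately show ?thesis
    by (simp add: blocks_def)
qed

text \<open>A shift by whole levels keeps the time index, since subtracting a multiple of
  \<open>k\<close> does not change a position modulo \<open>k\<close>. Later arguments see links
  only through this formula.\<close>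

lemma level_bit_received_block:
  assumes xs: "xs \<in> blocks q k" and ys: "ys \<in> blocks q k" and p: "p < k * q"
  shows "level_bit k (received_block q g i xs ys) p =
    delay (k * (q - g i 1)) (level_bit k xs) p + delay (k * (q - g i 2)) (level_bit k ys) p"
proof -
  have k: "k > 0"
    using p by (cases k) auto
  define t l where "t = p mod k" and "l = p div k"
  have tl: "t < k" "l < q"
    using k div_less_of_less_mult[OF p] by (auto simp: t_def l_def)
  have vecs: "xs ! t \<in> carrier_vec q" "ys ! t \<in> carrier_vec q"
    using xs ys tl by (auto simp: blocks_def subset_iff)
  have delay: "delay (k * s) (level_bit k zs) p = (if s \<le> l then zs ! t $ (l - s) else 0)" for s zs
  proof -
    have "k * s \<le> p \<longleftrightarrow> s \<le> l"
      using k by (simp add: l_def less_eq_div_iff_mult_less_eq mult.commute)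
    moreover have "(p - k * s) mod k = t" "(p - k * s) div k = l - s" if "k * s \<le> p"
    proof -
      obtain r where "p = k * s + r"
        using \<open>k * s \<le> p\<close> le_Suc_ex by blast
      then show "(p - k * s) mod k = t" "(p - k * s) div k = l - s"
        using k by (simp_all add: t_def l_def)
    qed
    ultimately show ?thesis
      by (auto simp: delay_def level_bit_def)
  qed
  have "level_bit k (received_block q g i xs ys) p = received q g i (xs ! t) (ys ! t) $ l"
    using xs ys tl by (simp add: level_bit_def received_block_def blocks_def t_def l_def)
  also have "\<dots> = (link_mat q (g i 1) *\<^sub>v xs ! t) $ l + (link_mat q (g i 2) *\<^sub>v ys ! t) $ l"
    using tl by (simp add: received_def link_mat_def shift_mat_pow)
  finally show ?thesis
    using vecs tl by (simp add: link_mat_mult_vec delay)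
qed

lemma blocks_eqI:
  assumes "xs \<in> blocks q k" "ys \<in> blocks q k"
    and eq: "\<And>p. p < k * q \<Longrightarrow> level_bit k xs p = level_bit k ys p"
  shows "xs = ys"
proof (rule nth_equalityI)
  show "length xs = length ys"
    using assms by (auto simp: blocks_def)
  fix t assume "t < length xs"
  then have t: "t < k"
    using assms by (auto simp: blocks_def)
  then have vecs: "xs ! t \<in> carrier_vec q" "ys ! t \<in> carrier_vec q"
    using assms by (auto simp: blocks_def subset_iff)
  show "xs ! t = ys ! t"
  proof (rule eq_vecI)
    fix l assume "l < dim_vec (ys ! t)"
    then have "l < q"
      using vecs by auto
    then have "Suc l * k \<le> q * k"
      by (intro mult_le_mono1) simp
    then have "l * k + t < k * q"
      using t by (simp add: mult.commute)
    then have "level_bit k xs (l * k + t) = level_bit k ys (l * k + t)"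
      by (rule eq)
    then show "xs ! t $ l = ys ! t $ l"
      using t by (simp add: level_bit_def)
  qed (use vecs in auto)
qed

section \<open>Counting by binary observations\<close>

lemma UNIV_bit: "(UNIV :: bit set) = {0, 1}"
  by (auto intro: bit.exhaust)

lemma card_UNIV_bit: "card (UNIV :: bit set) = 2"
  by (subst UNIV_bit) simp

lemma finite_UNIV_bit: "finite (UNIV :: bit set)"
  by (subst UNIV_bit) simp

text \<open>Pigeonhole behind every cut: key and observed bits together are an injective image of
  \<open>C\<close> in a finite product. The key models side information, such as knowledge of the
  other message.\<close>

lemma card_le_of_observations:
  fixes obs :: "'w \<Rightarrow> 's \<Rightarrow> bit" and obs' :: "'w \<Rightarrow> 't \<Rightarrow> bit"
  assumes "finite K" "finite S" "finite T" and key: "key ` C \<subseteq> K"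
    and inj: "\<And>v w. v \<in> C \<Longrightarrow> w \<in> C \<Longrightarrow> key v = key w \<Longrightarrow>
      (\<And>s. s \<in> S \<Longrightarrow> obs v s = obs w s) \<Longrightarrow> (\<And>t. t \<in> T \<Longrightarrow> obs' v t = obs' w t) \<Longrightarrow> v = w"
  shows "card C \<le> card K * 2 ^ (card S + card T)"
proof -
  let ?R = "K \<times> PiE S (\<lambda>_. UNIV :: bit set) \<times> PiE T (\<lambda>_. UNIV :: bit set)"
  let ?f = "\<lambda>w. (key w, restrict (obs w) S, restrict (obs' w) T)"
  have "inj_on ?f C"
  proof (rule inj_onI)
    fix v w assume vw: "v \<in> C" "w \<in> C" "?f v = ?f w"
    have restrict: "restrict (obs v) S = restrict (obs w) S" "restrict (obs' v) T = restrict (obs' w) T"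
      using vw(3) by simp_all
    have "obs v s = obs w s" if "s \<in> S" for s
      using restrict(1) that by (metis restrict_apply')
    moreover have "obs' v t = obs' w t" if "t \<in> T" for t
      using restrict(2) that by (metis restrict_apply')
    ultimately show "v = w"
      using vw by (intro inj) simp_all
  qed
  moreover have "?f ` C \<subseteq> ?R"
    using key by auto
  moreover have "finite ?R"
    using assms finite_UNIV_bit by (intro finite_cartesian_product finite_PiE) simp_all
  ultimately have "card C \<le> card ?R"
    by (rule card_inj_on_le)
  also have "\<dots> = card K * 2 ^ (card S + card T)"
    using assms by (simp add: card_cartesian_product card_PiE card_UNIV_bit power_add)
  finally show ?thesis .
qed

subsection \<open>Cut bounds\<close>

text \<open>With \<open>P = {..<k * g}\<close> this says that two transmitted blocks cannot be told
  apart through a link of gain \<open>g\<close>.\<close>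

definition agree :: "nat \<Rightarrow> nat set \<Rightarrow> bit vec list \<Rightarrow> bit vec list \<Rightarrow> bool" where
  "agree k P xs ys \<longleftrightarrow> (\<forall>p\<in>P. level_bit k xs p = level_bit k ys p)"

lemma agree_refl [simp]: "agree k P xs xs"
  by (simp add: agree_def)

lemma agree_mono: "agree k P xs ys \<Longrightarrow> P' \<subseteq> P \<Longrightarrow> agree k P' xs ys"
  by (auto simp: agree_def)

text \<open>For \<open>c \<le> b\<close> the second interval is empty and the first one covers the
  claim; this case accounts for the positive parts in the last two cuts.\<close>

lemma agree_lessThan_extend:
  assumes "agree k {..<k * b} xs ys" "agree k {k * b..<k * c} xs ys"
  shows "agree k {..<k * c} xs ys"
  unfolding agree_def
proof
  fix p assume "p \<in> {..<k * c}"
  then have "p \<in> {..<k * b} \<or> p \<in> {k * b..<k * c}"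
    by auto
  then show "level_bit k xs p = level_bit k ys p"
    using assms by (auto simp: agree_def)
qed

text \<open>A delay by \<open>k * (q - h)\<close>, read at a position below \<open>k * q\<close>,
  never reaches a transmitted position at or beyond \<open>k * h\<close>.\<close>

lemma received_block_cong:
  assumes blocks: "xs1 \<in> blocks q k" "xs2 \<in> blocks q k" "ys1 \<in> blocks q k" "ys2 \<in> blocks q k"
    and agree: "agree k {..<k * g i 1} xs1 ys1" "agree k {..<k * g i 2} xs2 ys2"
  shows "received_block q g i xs1 xs2 = received_block q g i ys1 ys2"
proof (rule blocks_eqI[where q = q and k = k])
  fix p assume p: "p < k * q"
  have "delay (k * (q - h)) (level_bit k xs) p = delay (k * (q - h)) (level_bit k ys) p"
    if "agree k {..<k * h} xs ys" for h xs ys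
  proof (cases "k * (q - h) \<le> p")
    case True
    have "k * q \<le> k * (q - h + h)"
      by (intro mult_le_mono2) simp
    then have "k * q \<le> k * (q - h) + k * h"
      by (simp only: distrib_left)
    then have "p - k * (q - h) < k * h"
      using p True by linarith
    then show ?thesis
      using that by (simp add: delay_def agree_def)
  qed (simp add: delay_def)
  then show "level_bit k (received_block q g i xs1 xs2) p = level_bit k (received_block q g i ys1 ys2) p"
    using blocks agree p by (simp add: level_bit_received_block)
qed (use blocks in \<open>simp_all add: received_block_in_blocks\<close>)

text \<open>Interference cancellation: a known signal can be subtracted from the received sum, and
  the delayed copy that remains exposes exactly the levels carried by the other link.\<close>

lemma received_block_cancel:
  assumes blocks: "xs1 \<in> blocks q k" "xs2 \<in> blocks q k" "ys1 \<in> blocks q k" "ys2 \<in> blocks q k"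
    and eq: "received_block q g i xs1 xs2 = received_block q g i ys1 ys2"
  shows received_block_cancel_left:
      "xs1 = ys1 \<Longrightarrow> g i 2 \<le> q \<Longrightarrow> agree k {..<k * g i 2} xs2 ys2"
    and received_block_cancel_right:
      "xs2 = ys2 \<Longrightarrow> g i 1 \<le> q \<Longrightarrow> agree k {..<k * g i 1} xs1 ys1"
proof -
  \<comment> \<open>Bit \<open>p\<close> is seen at receiver position
    \<open>p + k * (q - h)\<close>; with \<open>h \<le> q\<close> this position is still below
    \<open>k * q\<close>.\<close>
  have bit: "level_bit k xs p = level_bit k ys p"
    if "\<And>p. p < k * q \<Longrightarrow>
        delay (k * (q - h)) (level_bit k xs) p = delay (k * (q - h)) (level_bit k ys) p"
      and "h \<le> q" "p < k * h" for h xs ys p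
  proof -
    have "k * q = k * (q - h + h)"
      using \<open>h \<le> q\<close> by simp
    then have "k * q = k * (q - h) + k * h"
      by (simp only: distrib_left)
    then have "p + k * (q - h) < k * q"
      using \<open>p < k * h\<close> by linarith
    from that(1)[OF this] show ?thesis
      by (simp add: delay_def)
  qed
  have delays: "delay (k * (q - g i 1)) (level_bit k xs1) p + delay (k * (q - g i 2)) (level_bit k xs2) p =
      delay (k * (q - g i 1)) (level_bit k ys1) p + delay (k * (q - g i 2)) (level_bit k ys2) p"
    if "p < k * q" for p
  proof -
    have "delay (k * (q - g i 1)) (level_bit k xs1) p + delay (k * (q - g i 2)) (level_bit k xs2) p =
        level_bit k (received_block q g i xs1 xs2) p"
      by (rule level_bit_received_block[symmetric]) (use blocks that in auto)
    also have "\<dots> = delay (k * (q - g i 1)) (level_bit k ys1) p + delay (k * (q - g i 2)) (level_bit k ys2) p"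
      unfolding eq by (rule level_bit_received_block) (use blocks that in auto)
    finally show ?thesis .
  qed
  show "agree k {..<k * g i 2} xs2 ys2" if "xs1 = ys1" "g i 2 \<le> q"
  proof -
    have "delay (k * (q - g i 2)) (level_bit k xs2) p = delay (k * (q - g i 2)) (level_bit k ys2) p"
      if "p < k * q" for p
      using delays[OF that] unfolding \<open>xs1 = ys1\<close> by (rule add_left_imp_eq)
    then show ?thesis
      unfolding agree_def using bit \<open>g i 2 \<le> q\<close> by blast
  qed
  show "agree k {..<k * g i 1} xs1 ys1" if "xs2 = ys2" "g i 1 \<le> q"
  proof -
    have "delay (k * (q - g i 1)) (level_bit k xs1) p = delay (k * (q - g i 1)) (level_bit k ys1) p"
      if "p < k * q" for p
      using delays[OF that] unfolding \<open>xs2 = ys2\<close> by (rule add_right_imp_eq)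
    then show ?thesis
      unfolding agree_def using bit \<open>g i 1 \<le> q\<close> by blast
  qed
qed

text \<open>The positions below the given interval are reached by neither link and are always
  0.\<close>

lemma received_block_eqI:
  assumes blocks: "xs1 \<in> blocks q k" "xs2 \<in> blocks q k" "ys1 \<in> blocks q k" "ys2 \<in> blocks q k"
    and agree: "agree k {k * (q - max (g i 1) (g i 2))..<k * q}
      (received_block q g i xs1 xs2) (received_block q g i ys1 ys2)"
  shows "received_block q g i xs1 xs2 = received_block q g i ys1 ys2"
proof (rule blocks_eqI[where q = q and k = k])
  fix p assume p: "p < k * q"
  show "level_bit k (received_block q g i xs1 xs2) p = level_bit k (received_block q g i ys1 ys2) p"
  proof (cases "k * (q - max (g i 1) (g i 2)) \<le> p")
    case True
    then show ?thesis
      using agree p by (simp add: agree_def)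
  next
    case False
    have "k * (q - max (g i 1) (g i 2)) \<le> k * (q - g i 1)"
      by (intro mult_le_mono2 diff_le_mono2) simp
    moreover have "k * (q - max (g i 1) (g i 2)) \<le> k * (q - g i 2)"
      by (intro mult_le_mono2 diff_le_mono2) simp
    ultimately have "p < k * (q - g i 1)" "p < k * (q - g i 2)"
      using False by linarith+
    then show ?thesis
      using blocks p by (simp add: level_bit_received_block delay_def)
  qed
qed (use blocks in \<open>simp_all add: received_block_in_blocks\<close>)

lemma card_top_levels: "g \<le> q \<Longrightarrow> card {k * (q - g)..<k * q} = k * (g::nat)"
  by (simp flip: diff_mult_distrib2)

lemma card_levels_between: "card {k * a..<k * b} = k * (b - a :: nat)"
  by (simp add: diff_mult_distrib2)

section \<open>Correctly decoded pairs of a fixed code\<close>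

locale zs_code =
  fixes q k :: nat and m n :: "nat \<Rightarrow> nat \<Rightarrow> nat" and c :: two_stage_code
  assumes code: "is_code q k c"
    and m_le: "\<And>i j. i \<in> {1, 2} \<Longrightarrow> j \<in> {1, 2} \<Longrightarrow> m i j \<le> q"
    and n_le: "\<And>i j. i \<in> {1, 2} \<Longrightarrow> j \<in> {1, 2} \<Longrightarrow> n i j \<le> q"
    and zs: "m 2 1 = 0" "n 1 2 = 0"
begin

definition src :: "nat \<Rightarrow> nat \<times> nat \<Rightarrow> bit vec list" where
  "src i w = encoder c i (if i = 1 then fst w else snd w)"

abbreviation relay_in :: "nat \<Rightarrow> nat \<times> nat \<Rightarrow> bit vec list" where
  "relay_in i w \<equiv> received_block q m i (src 1 w) (src 2 w)"

abbreviation relay_out :: "nat \<Rightarrow> nat \<times> nat \<Rightarrow> bit vec list" where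
  "relay_out \<equiv> relay_block q m c"

abbreviation dest_in :: "nat \<Rightarrow> nat \<times> nat \<Rightarrow> bit vec list" where
  "dest_in i w \<equiv> received_block q n i (relay_out 1 w) (relay_out 2 w)"

text \<open>On this set the message of each user is a function of the input of its destination,
  without exceptions, which makes exact counting possible.\<close>

definition correct :: "(nat \<times> nat) set" where
  "correct = {w \<in> messages c 1 \<times> messages c 2. (decoded q m n c 1 w, decoded q m n c 2 w) = w}"

lemma relay_out_eq: "relay_out i w = relay_map c i (relay_in i w)"
  by (simp add: relay_block_def src_def)

lemma correct_subset: "correct \<subseteq> messages c 1 \<times> messages c 2"
  by (auto simp: correct_def)

lemma finite_messages: "finite (messages c 1)" "finite (messages c 2)"
  and messages_nonempty: "messages c 1 \<noteq> {}" "messages c 2 \<noteq> {}"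
  using code by (auto simp: is_code_def)

lemma src_in_blocks: "w \<in> correct \<Longrightarrow> src 1 w \<in> blocks q k" "w \<in> correct \<Longrightarrow> src 2 w \<in> blocks q k"
  using code subsetD[OF correct_subset, of w]
  by (auto simp: is_code_def src_def Pi_iff mem_Times_iff)

lemma relay_out_in_blocks:
  "w \<in> correct \<Longrightarrow> relay_out 1 w \<in> blocks q k" "w \<in> correct \<Longrightarrow> relay_out 2 w \<in> blocks q k"
  using code src_in_blocks received_block_in_blocks
  by (auto simp: is_code_def relay_out_eq Pi_iff)

lemma src_cong: "fst v = fst w \<Longrightarrow> src 1 v = src 1 w" "snd v = snd w \<Longrightarrow> src 2 v = src 2 w"
  by (simp_all add: src_def)

lemma relay_out_cong: "relay_in i v = relay_in i w \<Longrightarrow> relay_out i v = relay_out i w"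
  by (simp add: relay_out_eq)

lemma fst_eq_of_dest_in:
  assumes "v \<in> correct" "w \<in> correct" "dest_in 1 v = dest_in 1 w"
  shows "fst v = fst w"
proof -
  have "decoded q m n c 1 v = decoded q m n c 1 w"
    using assms(3) by (simp add: decoded_def)
  then show ?thesis
    using assms(1,2) unfolding correct_def by (metis (mono_tags, lifting) fst_conv mem_Collect_eq)
qed

lemma snd_eq_of_dest_in:
  assumes "v \<in> correct" "w \<in> correct" "dest_in 2 v = dest_in 2 w"
  shows "snd v = snd w"
proof -
  have "decoded q m n c 2 v = decoded q m n c 2 w"
    using assms(3) by (simp add: decoded_def)
  then show ?thesis
    using assms(1,2) unfolding correct_def by (metis (mono_tags, lifting) snd_conv mem_Collect_eq)
qed

lemma relay_in_cong:
  assumes "v \<in> correct" "w \<in> correct"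
    and "agree k {..<k * m i 1} (src 1 v) (src 1 w)" "agree k {..<k * m i 2} (src 2 v) (src 2 w)"
  shows "relay_in i v = relay_in i w"
  using assms by (intro received_block_cong) (simp_all add: src_in_blocks)

lemma dest_in_cong:
  assumes "v \<in> correct" "w \<in> correct"
    and "agree k {..<k * n i 1} (relay_out 1 v) (relay_out 1 w)"
      "agree k {..<k * n i 2} (relay_out 2 v) (relay_out 2 w)"
  shows "dest_in i v = dest_in i w"
  using assms by (intro received_block_cong) (simp_all add: relay_out_in_blocks)

text \<open>As \<open>m 2 1 = 0\<close>, the second relay hears the second source only; agreement on
  the first source is over the empty set.\<close>

lemma relay_out_2_cong:
  assumes "v \<in> correct" "w \<in> correct" "agree k {..<k * m 2 2} (src 2 v) (src 2 w)"
  shows "relay_out 2 v = relay_out 2 w"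
  using assms zs by (intro relay_out_cong relay_in_cong) (simp_all add: agree_def)

text \<open>As \<open>n 1 2 = 0\<close>, the first destination hears the first relay only, so the
  output of that relay already fixes the first message.\<close>

lemma fst_eqI:
  assumes "v \<in> correct" "w \<in> correct" "agree k {..<k * n 1 1} (relay_out 1 v) (relay_out 1 w)"
  shows "fst v = fst w"
  using assms zs by (intro fst_eq_of_dest_in dest_in_cong) (simp_all add: agree_def)

lemma snd_eqI:
  assumes "v \<in> correct" "w \<in> correct" "agree k {..<k * n 2 1} (relay_out 1 v) (relay_out 1 w)"
    "agree k {..<k * n 2 2} (relay_out 2 v) (relay_out 2 w)"
  shows "snd v = snd w"
  using assms by (intro snd_eq_of_dest_in dest_in_cong)

lemma eq_of_relay_out:
  assumes "v \<in> correct" "w \<in> correct" "relay_out 1 v = relay_out 1 w" "relay_out 2 v = relay_out 2 w"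
  shows "v = w"
  using assms by (auto intro!: prod_eqI fst_eqI snd_eqI)

text \<open>Common form of all cuts: free side information \<open>key\<close> and two windows of
  positions on two signals. Cuts with a single window take \<open>P' = {}\<close>.\<close>

lemma card_correct_le:
  fixes key :: "nat \<times> nat \<Rightarrow> nat" and obs obs' :: "nat \<times> nat \<Rightarrow> bit vec list"
  assumes "finite K" "finite P" "finite P'" "key ` correct \<subseteq> K"
    and "card P + card P' = k * N"
    and "\<And>v w. v \<in> correct \<Longrightarrow> w \<in> correct \<Longrightarrow> key v = key w \<Longrightarrow>
      agree k P (obs v) (obs w) \<Longrightarrow> agree k P' (obs' v) (obs' w) \<Longrightarrow> v = w"
  shows "card correct \<le> card K * 2 ^ (k * N)"
  unfolding assms(5)[symmetric]
  by (rule card_le_of_observations[where obs = "\<lambda>w. level_bit k (obs w)" and obs' = "\<lambda>w. level_bit k (obs' w)"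
        and key = key])
    (use assms in \<open>auto simp: agree_def\<close>)

lemma card_correct_le_sum:
  fixes obs obs' :: "nat \<times> nat \<Rightarrow> bit vec list"
  assumes "finite P" "finite P'" "card P + card P' = k * N"
    and "\<And>v w. v \<in> correct \<Longrightarrow> w \<in> correct \<Longrightarrow>
      agree k P (obs v) (obs w) \<Longrightarrow> agree k P' (obs' v) (obs' w) \<Longrightarrow> v = w"
  shows "card correct \<le> 2 ^ (k * N)"
  \<comment> \<open>A constant key gives no side information, so all pairs are counted and a
    sum-rate bound results.\<close>
  using card_correct_le[of "{0}" P P' "\<lambda>_. 0" N obs obs'] assms by auto

text \<open>The key is the second message. Its factor is cancelled later, which leaves a bound on
  the first rate alone.\<close>

lemma card_correct_le_fst:
  fixes obs obs' :: "nat \<times> nat \<Rightarrow> bit vec list"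
  assumes "finite P" "finite P'" "card P + card P' = k * N"
    and "\<And>v w. v \<in> correct \<Longrightarrow> w \<in> correct \<Longrightarrow> snd v = snd w \<Longrightarrow>
      agree k P (obs v) (obs w) \<Longrightarrow> agree k P' (obs' v) (obs' w) \<Longrightarrow> fst v = fst w"
  shows "card correct \<le> card (messages c 2) * 2 ^ (k * N)"
  using correct_subset
  by (intro card_correct_le[where P = P and P' = P' and key = snd and obs = obs and obs' = obs'])
    (use assms finite_messages in \<open>auto intro!: prod_eqI\<close>)

lemma card_correct_le_snd:
  fixes obs obs' :: "nat \<times> nat \<Rightarrow> bit vec list"
  assumes "finite P" "finite P'" "card P + card P' = k * N"
    and "\<And>v w. v \<in> correct \<Longrightarrow> w \<in> correct \<Longrightarrow> fst v = fst w \<Longrightarrow>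
      agree k P (obs v) (obs w) \<Longrightarrow> agree k P' (obs' v) (obs' w) \<Longrightarrow> snd v = snd w"
  shows "card correct \<le> card (messages c 1) * 2 ^ (k * N)"
  using correct_subset
  by (intro card_correct_le[where P = P and P' = P' and key = fst and obs = obs and obs' = obs'])
    (use assms finite_messages in \<open>auto intro!: prod_eqI\<close>)

section \<open>The ten cuts, one for each bound of the region\<close>

lemma cut_m11: "card correct \<le> card (messages c 2) * 2 ^ (k * m 1 1)"
proof (rule card_correct_le_fst[where P = "{..<k * m 1 1}" and P' = "{}" and obs = "src 1" and obs' = "src 1"])
  fix v w
  assume vw: "v \<in> correct" "w \<in> correct" "snd v = snd w"
    and obs: "agree k {..<k * m 1 1} (src 1 v) (src 1 w)"
  have "relay_out 1 v = relay_out 1 w"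
    using vw obs by (intro relay_out_cong relay_in_cong) (simp_all add: src_cong(2)[OF vw(3)])
  then show "fst v = fst w"
    using vw by (intro fst_eqI) simp_all
qed simp_all

lemma cut_n11: "card correct \<le> card (messages c 2) * 2 ^ (k * n 1 1)"
proof (rule card_correct_le_fst[where P = "{..<k * n 1 1}" and P' = "{}"
      and obs = "relay_out 1" and obs' = "relay_out 1"])
  fix v w
  assume "v \<in> correct" "w \<in> correct" "agree k {..<k * n 1 1} (relay_out 1 v) (relay_out 1 w)"
  then show "fst v = fst w"
    by (rule fst_eqI)
qed simp_all

text \<open>Neither relay hears more of the second source than the window shows; with the first
  message known, this fixes both relay outputs.\<close>

lemma cut_m12_m22: "card correct \<le> card (messages c 1) * 2 ^ (k * max (m 1 2) (m 2 2))"
proof (rule card_correct_le_snd[where P = "{..<k * max (m 1 2) (m 2 2)}" and P' = "{}"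
      and obs = "src 2" and obs' = "src 2"])
  fix v w
  assume vw: "v \<in> correct" "w \<in> correct" "fst v = fst w"
    and obs: "agree k {..<k * max (m 1 2) (m 2 2)} (src 2 v) (src 2 w)"
  have "agree k {..<k * m 1 2} (src 2 v) (src 2 w)" "agree k {..<k * m 2 2} (src 2 v) (src 2 w)"
    by (rule agree_mono[OF obs], simp)+
  then have "relay_in 1 v = relay_in 1 w" "relay_out 2 v = relay_out 2 w"
    using vw by (intro relay_in_cong relay_out_2_cong; simp add: src_cong(1)[OF vw(3)])+
  moreover from this(1) have "relay_out 1 v = relay_out 1 w"
    by (rule relay_out_cong)
  ultimately show "snd v = snd w"
    using eq_of_relay_out[OF vw(1,2)] by simp
qed simp_all

lemma cut_n21_n22: "card correct \<le> card (messages c 1) * 2 ^ (k * max (n 2 1) (n 2 2))"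
proof (rule card_correct_le_snd[where P = "{k * (q - max (n 2 1) (n 2 2))..<k * q}" and P' = "{}"
      and obs = "dest_in 2" and obs' = "dest_in 2"])
  fix v w
  assume vw: "v \<in> correct" "w \<in> correct"
    and obs: "agree k {k * (q - max (n 2 1) (n 2 2))..<k * q} (dest_in 2 v) (dest_in 2 w)"
  show "snd v = snd w"
    using vw obs by (intro snd_eq_of_dest_in received_block_eqI[where k = k] relay_out_in_blocks)
qed (simp_all add: card_top_levels n_le del: card_atLeastLessThan)

text \<open>With the first message known, the \<open>m 1 2\<close> levels heard by the first relay
  fix its output; the second destination then depends only on the \<open>n 2 2\<close> levels it
  hears from the second relay.\<close>

lemma cut_m12_n22: "card correct \<le> card (messages c 1) * 2 ^ (k * (m 1 2 + n 2 2))"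
proof (rule card_correct_le_snd[where P = "{..<k * m 1 2}" and P' = "{..<k * n 2 2}"
      and obs = "src 2" and obs' = "relay_out 2"])
  fix v w
  assume vw: "v \<in> correct" "w \<in> correct" "fst v = fst w"
    and obs: "agree k {..<k * m 1 2} (src 2 v) (src 2 w)"
      "agree k {..<k * n 2 2} (relay_out 2 v) (relay_out 2 w)"
  have "relay_out 1 v = relay_out 1 w"
    using vw obs by (intro relay_out_cong relay_in_cong) (simp_all add: src_cong(1)[OF vw(3)])
  then show "snd v = snd w"
    using vw obs by (intro snd_eqI) simp_all
qed (simp_all add: distrib_left)

text \<open>Here the roles of the relays are swapped: the \<open>m 2 2\<close> levels fix the output
  of the second relay, and \<open>n 2 1\<close> levels of the first one are observed.\<close>

lemma cut_m22_n21: "card correct \<le> card (messages c 1) * 2 ^ (k * (m 2 2 + n 2 1))"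
proof (rule card_correct_le_snd[where P = "{..<k * m 2 2}" and P' = "{..<k * n 2 1}"
      and obs = "src 2" and obs' = "relay_out 1"])
  fix v w
  assume vw: "v \<in> correct" "w \<in> correct"
    and obs: "agree k {..<k * m 2 2} (src 2 v) (src 2 w)"
      "agree k {..<k * n 2 1} (relay_out 1 v) (relay_out 1 w)"
  show "snd v = snd w"
    using vw obs by (intro snd_eqI) (simp_all add: relay_out_2_cong[OF vw obs(1)])
qed (simp_all add: distrib_left)

lemma relay_in_1_eqI:
  assumes "v \<in> correct" "w \<in> correct"
    and "agree k {k * (q - max (m 1 1) (m 1 2))..<k * q} (relay_in 1 v) (relay_in 1 w)"
  shows "relay_in 1 v = relay_in 1 w"
  using assms by (intro received_block_eqI[where k = k] src_in_blocks)

text \<open>The input of the first relay fixes its output and hence the first message. Adding what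
  the second destination hears from the second relay gives the second message.\<close>

lemma cut_m11_m12_n22: "card correct \<le> 2 ^ (k * (max (m 1 1) (m 1 2) + n 2 2))"
proof (rule card_correct_le_sum[where P = "{k * (q - max (m 1 1) (m 1 2))..<k * q}"
      and P' = "{..<k * n 2 2}" and obs = "relay_in 1" and obs' = "relay_out 2"])
  fix v w
  assume vw: "v \<in> correct" "w \<in> correct"
    and obs: "agree k {k * (q - max (m 1 1) (m 1 2))..<k * q} (relay_in 1 v) (relay_in 1 w)"
      "agree k {..<k * n 2 2} (relay_out 2 v) (relay_out 2 w)"
  have "relay_out 1 v = relay_out 1 w"
    using vw obs by (intro relay_out_cong relay_in_1_eqI)
  then show "v = w"
    using vw obs by (intro prod_eqI fst_eqI snd_eqI) simp_all
qed (simp_all add: card_top_levels m_le distrib_left del: card_atLeastLessThan)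

text \<open>The \<open>m 2 2\<close> levels fix the output of the second relay, and the larger
  window on the first relay's output serves both destinations.\<close>

lemma cut_m22_n11_n21: "card correct \<le> 2 ^ (k * (m 2 2 + max (n 1 1) (n 2 1)))"
proof (rule card_correct_le_sum[where P = "{..<k * m 2 2}" and P' = "{..<k * max (n 1 1) (n 2 1)}"
      and obs = "src 2" and obs' = "relay_out 1"])
  fix v w
  assume vw: "v \<in> correct" "w \<in> correct"
    and obs: "agree k {..<k * m 2 2} (src 2 v) (src 2 w)"
      "agree k {..<k * max (n 1 1) (n 2 1)} (relay_out 1 v) (relay_out 1 w)"
  have "agree k {..<k * n 1 1} (relay_out 1 v) (relay_out 1 w)"
    "agree k {..<k * n 2 1} (relay_out 1 v) (relay_out 1 w)"
    by (rule agree_mono[OF obs(2)], simp)+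
  then show "v = w"
    using vw obs(1) by (intro prod_eqI fst_eqI snd_eqI) (simp_all add: relay_out_2_cong[OF vw obs(1)])
qed (simp_all add: distrib_left)

text \<open>The first relay's input yields the first message and, after cancellation,
  \<open>m 1 2\<close> levels of the second source. Levels heard by the second relay alone add
  \<open>m 2 2 - m 1 2\<close>; then both relay outputs are known.\<close>

lemma cut_m11_m12_m22: "card correct \<le> 2 ^ (k * (max (m 1 1) (m 1 2) + (m 2 2 - m 1 2)))"
proof (rule card_correct_le_sum[where P = "{k * (q - max (m 1 1) (m 1 2))..<k * q}"
      and P' = "{k * m 1 2..<k * m 2 2}" and obs = "relay_in 1" and obs' = "src 2"])
  fix v w
  assume vw: "v \<in> correct" "w \<in> correct"
    and obs: "agree k {k * (q - max (m 1 1) (m 1 2))..<k * q} (relay_in 1 v) (relay_in 1 w)"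
      "agree k {k * m 1 2..<k * m 2 2} (src 2 v) (src 2 w)"
  have relay_in: "relay_in 1 v = relay_in 1 w"
    using vw obs by (intro relay_in_1_eqI)
  then have relay_out: "relay_out 1 v = relay_out 1 w"
    by (rule relay_out_cong)
  then have fst: "fst v = fst w"
    using vw by (intro fst_eqI) simp_all
  have "agree k {..<k * m 1 2} (src 2 v) (src 2 w)"
    using vw by (intro received_block_cancel_left[OF _ _ _ _ relay_in])
      (simp_all add: src_in_blocks src_cong(1)[OF fst] m_le)
  then have "agree k {..<k * m 2 2} (src 2 v) (src 2 w)"
    using obs(2) by (rule agree_lessThan_extend)
  then show "v = w"
    using vw relay_out by (intro eq_of_relay_out relay_out_2_cong)
qed (simp_all add: card_top_levels m_le card_levels_between distrib_left del: card_atLeastLessThan)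

text \<open>The second destination's input yields the second message, hence the second relay's
  output, and after cancellation \<open>n 2 1\<close> levels of the first relay's output. The first
  destination may hear \<open>n 1 1 - n 2 1\<close> levels more.\<close>

lemma cut_n21_n22_n11: "card correct \<le> 2 ^ (k * (max (n 2 1) (n 2 2) + (n 1 1 - n 2 1)))"
proof (rule card_correct_le_sum[where P = "{k * (q - max (n 2 1) (n 2 2))..<k * q}"
      and P' = "{k * n 2 1..<k * n 1 1}" and obs = "dest_in 2" and obs' = "relay_out 1"])
  fix v w
  assume vw: "v \<in> correct" "w \<in> correct"
    and obs: "agree k {k * (q - max (n 2 1) (n 2 2))..<k * q} (dest_in 2 v) (dest_in 2 w)"
      "agree k {k * n 2 1..<k * n 1 1} (relay_out 1 v) (relay_out 1 w)"
  have dest_in: "dest_in 2 v = dest_in 2 w"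
    using vw obs by (intro received_block_eqI[where k = k] relay_out_in_blocks)
  then have snd: "snd v = snd w"
    using vw by (intro snd_eq_of_dest_in)
  then have "relay_out 2 v = relay_out 2 w"
    using vw by (intro relay_out_2_cong) (simp_all add: src_cong(2)[OF snd])
  then have "agree k {..<k * n 2 1} (relay_out 1 v) (relay_out 1 w)"
    using vw by (intro received_block_cancel_right[OF _ _ _ _ dest_in])
      (simp_all add: relay_out_in_blocks n_le)
  then have "agree k {..<k * n 1 1} (relay_out 1 v) (relay_out 1 w)"
    using obs(2) by (rule agree_lessThan_extend)
  then show "v = w"
    using vw snd by (intro prod_eqI fst_eqI)
qed (simp_all add: card_top_levels n_le card_levels_between distrib_left del: card_atLeastLessThan)

text \<open>The message pair is uniform on the product set, so the success probability is the
  fraction of correctly decoded pairs.\<close>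

lemma card_correct_eq:
  "(1 - error_prob q m n c) * (card (messages c 1) * card (messages c 2)) = card correct"
proof -
  let ?W = "messages c 1 \<times> messages c 2"
  have W: "finite ?W" "?W \<noteq> {}"
    using finite_messages messages_nonempty by auto
  have "pair_pmf (pmf_of_set (messages c 1)) (pmf_of_set (messages c 2)) = pmf_of_set ?W"
  proof (rule pmf_eqI)
    fix w
    show "pmf (pair_pmf (pmf_of_set (messages c 1)) (pmf_of_set (messages c 2))) w = pmf (pmf_of_set ?W) w"
      using finite_messages messages_nonempty
      by (cases w) (simp add: pmf_pair pmf_of_set indicator_def card_cartesian_product)
  qed
  moreover have Int_errors: "?W \<inter> {w. (decoded q m n c 1 w, decoded q m n c 2 w) \<noteq> w} = ?W - correct"
    by (auto simp: correct_def)
  ultimately have "error_prob q m n c = card (?W - correct) / card ?W"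
    by (simp only: error_prob_def measure_pmf_of_set[OF W(2,1)])
  moreover have "card (?W - correct) = card ?W - card correct"
    by (rule card_Diff_subset) (use W(1) correct_subset in \<open>auto intro: finite_subset\<close>)
  moreover have "card correct \<le> card ?W"
    using W(1) correct_subset by (rule card_mono)
  moreover have "card ?W > 0"
    using W card_gt_0_iff by blast
  moreover have "(1 - (x - y) / x) * x = y" if "x > 0" for x y :: real
    using that by (simp add: field_simps)
  ultimately have "(1 - error_prob q m n c) * card ?W = card correct"
    by (simp only: of_nat_diff of_nat_0_less_iff)
  then show ?thesis
    by (simp only: card_cartesian_product of_nat_mult)
qed

lemma sum_rate_bound:
  assumes "card correct \<le> 2 ^ (k * N)"
  shows "(1 - error_prob q m n c) * (card (messages c 1) * card (messages c 2)) \<le> 2 ^ (k * N)"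
proof -
  have "real (card correct) \<le> real (2 ^ (k * N))"
    using assms by (rule of_nat_mono)
  then show ?thesis
    by (simp only: card_correct_eq of_nat_power of_nat_numeral)
qed

lemma first_rate_bound:
  assumes "card correct \<le> card (messages c 2) * 2 ^ (k * N)"
  shows "(1 - error_prob q m n c) * card (messages c 1) \<le> 2 ^ (k * N)"
proof -
  have "card (messages c 2) > 0"
    using finite_messages messages_nonempty by (simp add: card_gt_0_iff)
  moreover have "real (card correct) \<le> real (card (messages c 2) * 2 ^ (k * N))"
    using assms by (rule of_nat_mono)
  then have "real (card (messages c 2)) * ((1 - error_prob q m n c) * card (messages c 1))
      \<le> real (card (messages c 2)) * 2 ^ (k * N)"
    by (simp only: card_correct_eq[symmetric] of_nat_mult of_nat_power of_nat_numeral mult_ac)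
  ultimately show ?thesis
    by simp
qed

lemma second_rate_bound:
  assumes "card correct \<le> card (messages c 1) * 2 ^ (k * N)"
  shows "(1 - error_prob q m n c) * card (messages c 2) \<le> 2 ^ (k * N)"
proof -
  have "card (messages c 1) > 0"
    using finite_messages messages_nonempty by (simp add: card_gt_0_iff)
  moreover have "real (card correct) \<le> real (card (messages c 1) * 2 ^ (k * N))"
    using assms by (rule of_nat_mono)
  then have "real (card (messages c 1)) * ((1 - error_prob q m n c) * card (messages c 2))
      \<le> real (card (messages c 1)) * 2 ^ (k * N)"
    by (simp only: card_correct_eq[symmetric] of_nat_mult of_nat_power of_nat_numeral mult_ac)
  ultimately show ?thesis
    by simp
qed

end

subsection \<open>From cut bounds to rates\<close>

text \<open>An excess of \<open>r\<close> over \<open>N\<close> grows exponentially in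
  \<open>k\<close> and beats the constant factor \<open>1 - \<epsilon>\<close>. The slack is
  \<open>2 * \<epsilon>\<close> because in a sum of rates each user loses
  \<open>\<epsilon>\<close>.\<close>

lemma rate_le_of_eventually:
  fixes r :: real
  assumes "\<And>\<epsilon>. 0 < \<epsilon> \<Longrightarrow> \<forall>\<^sub>F k in sequentially. (1 - \<epsilon>) * 2 powr (real k * (r - 2 * \<epsilon>)) \<le> 2 ^ (k * N)"
  shows "r \<le> real N"
proof (rule ccontr)
  assume "\<not> r \<le> real N"
  \<comment> \<open>Half of the gap between \<open>r\<close> and \<open>N\<close> pays for
    \<open>2 * \<epsilon>\<close>, the other half remains as excess;
    \<open>\<epsilon> \<le> 1 / 2\<close> keeps the factor at least \<open>1 / 2\<close>, which is
    offset once \<open>k * \<delta> > 1\<close>.\<close>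
  define \<delta> where "\<delta> = (r - N) / 2"
  define \<epsilon> where "\<epsilon> = min (1 / 2) (\<delta> / 2)"
  have pos: "\<delta> > 0" "\<epsilon> > 0" and \<epsilon>: "\<epsilon> \<le> 1 / 2" "2 * \<epsilon> \<le> \<delta>"
    using \<open>\<not> r \<le> real N\<close> by (auto simp: \<delta>_def \<epsilon>_def min_def)
  have "\<forall>\<^sub>F k in sequentially. 1 / \<delta> < real k"
    using filterlim_real_sequentially by (simp add: filterlim_at_top_dense)
  with assms[OF pos(2)] have "\<forall>\<^sub>F k::nat in sequentially. False"
  proof eventually_elim
    case (elim k)
    then have "1 < real k * \<delta>"
      using pos by (simp add: field_simps)
    moreover have "real k * \<delta> \<le> real k * (r - 2 * \<epsilon> - N)"
      using \<epsilon> by (intro mult_left_mono) (simp_all add: \<delta>_def field_simps)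
    ultimately have "real (k * N) + 1 < real k * (r - 2 * \<epsilon>)"
      by (simp add: algebra_simps)
    then have "2 powr (real (k * N) + 1) < 2 powr (real k * (r - 2 * \<epsilon>))"
      by simp
    then have "2 ^ (k * N) < 1 / 2 * 2 powr (real k * (r - 2 * \<epsilon>))"
      by (simp add: powr_add powr_realpow del: of_nat_mult)
    also have "\<dots> \<le> (1 - \<epsilon>) * 2 powr (real k * (r - 2 * \<epsilon>))"
      using \<epsilon> by (intro mult_right_mono) simp_all
    finally show False
      using elim by simp
  qed
  then show False
    by simp
qed

lemma sum_rate_le:
  assumes adm: "admissible q m n r1 r2"
    and bound: "\<And>k c. is_code q k c \<Longrightarrow>
      (1 - error_prob q m n c) * (card (messages c 1) * card (messages c 2)) \<le> 2 ^ (k * N)"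
  shows "r1 + r2 \<le> real N"
proof (rule rate_le_of_eventually)
  fix \<epsilon> :: real assume "0 < \<epsilon>"
  have "\<forall>\<^sub>F k in sequentially. \<exists>c. is_code q k c \<and>
        real (card (messages c 1)) \<ge> 2 powr (real k * (r1 - \<epsilon>)) \<and>
        real (card (messages c 2)) \<ge> 2 powr (real k * (r2 - \<epsilon>)) \<and>
        error_prob q m n c \<le> \<epsilon>"
    using adm \<open>0 < \<epsilon>\<close> by (simp add: admissible_def)
  then show "\<forall>\<^sub>F k in sequentially. (1 - \<epsilon>) * 2 powr (real k * (r1 + r2 - 2 * \<epsilon>)) \<le> 2 ^ (k * N)"
  proof eventually_elim
    case (elim k)
    then obtain c where c: "is_code q k c"
      "2 powr (real k * (r1 - \<epsilon>)) \<le> card (messages c 1)"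
      "2 powr (real k * (r2 - \<epsilon>)) \<le> card (messages c 2)"
      "error_prob q m n c \<le> \<epsilon>"
      by blast
    show ?case
    \<comment> \<open>Monotonicity of products needs \<open>1 - \<epsilon> \<ge> 0\<close>; for
      larger \<open>\<epsilon>\<close> the left side is not positive.\<close>
    proof (cases "\<epsilon> \<le> 1")
      case True
      have "2 powr (real k * (r1 + r2 - 2 * \<epsilon>)) = 2 powr (real k * (r1 - \<epsilon>)) * 2 powr (real k * (r2 - \<epsilon>))"
        by (simp add: algebra_simps flip: powr_add)
      also have "\<dots> \<le> real (card (messages c 1)) * real (card (messages c 2))"
        using c by (intro mult_mono) simp_all
      finally have "(1 - \<epsilon>) * 2 powr (real k * (r1 + r2 - 2 * \<epsilon>)) \<le>
          (1 - error_prob q m n c) * (real (card (messages c 1)) * real (card (messages c 2)))"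
        using c(4) True by (intro mult_mono) simp_all
      also have "\<dots> \<le> 2 ^ (k * N)"
        using bound[OF c(1)] by simp
      finally show ?thesis .
    next
      case False
      then have "(1 - \<epsilon>) * 2 powr (real k * (r1 + r2 - 2 * \<epsilon>)) \<le> 0"
        by (simp add: mult_le_0_iff)
      also have "0 \<le> (2::real) ^ (k * N)"
        by simp
      finally show ?thesis .
    qed
  qed
qed

lemma single_rate_le:
  assumes adm: "admissible q m n r1 r2" and "i = 1 \<and> r = r1 \<or> i = 2 \<and> r = r2"
    and bound: "\<And>k c. is_code q k c \<Longrightarrow>
      (1 - error_prob q m n c) * card (messages c i) \<le> 2 ^ (k * N)"
  shows "r \<le> real N"
proof (rule rate_le_of_eventually)
  fix \<epsilon> :: real assume "0 < \<epsilon>"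
  have "\<forall>\<^sub>F k in sequentially. \<exists>c. is_code q k c \<and>
        real (card (messages c 1)) \<ge> 2 powr (real k * (r1 - \<epsilon>)) \<and>
        real (card (messages c 2)) \<ge> 2 powr (real k * (r2 - \<epsilon>)) \<and>
        error_prob q m n c \<le> \<epsilon>"
    using adm \<open>0 < \<epsilon>\<close> by (simp add: admissible_def)
  then show "\<forall>\<^sub>F k in sequentially. (1 - \<epsilon>) * 2 powr (real k * (r - 2 * \<epsilon>)) \<le> 2 ^ (k * N)"
  proof eventually_elim
    case (elim k)
    then obtain c where c: "is_code q k c"
      "2 powr (real k * (r - \<epsilon>)) \<le> card (messages c i)" "error_prob q m n c \<le> \<epsilon>"
      using assms(2) by blast
    show ?case
    proof (cases "\<epsilon> \<le> 1")
      case True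
      \<comment> \<open>One more \<open>\<epsilon>\<close> is given away to match the slack used for
        sums.\<close>
      have "2 powr (real k * (r - 2 * \<epsilon>)) \<le> 2 powr (real k * (r - \<epsilon>))"
        using \<open>0 < \<epsilon>\<close> by (simp add: mult_left_mono)
      then have "2 powr (real k * (r - 2 * \<epsilon>)) \<le> card (messages c i)"
        using c(2) by linarith
      then have "(1 - \<epsilon>) * 2 powr (real k * (r - 2 * \<epsilon>)) \<le>
          (1 - error_prob q m n c) * card (messages c i)"
        using c(3) True by (intro mult_mono) simp_all
      also have "\<dots> \<le> 2 ^ (k * N)"
        by (rule bound[OF c(1)])
      finally show ?thesis .
    next
      case False
      then have "(1 - \<epsilon>) * 2 powr (real k * (r - 2 * \<epsilon>)) \<le> 0"
        by (simp add: mult_le_0_iff)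
      also have "0 \<le> (2::real) ^ (k * N)"
        by simp
      finally show ?thesis .
    qed
  qed
qed

subsection \<open>Routing\<close>

text \<open>Bits \<open>p\<close> and \<open>p'\<close> meet when
  \<open>p + k * (q - g i 1) = p' + k * (q - g i 2)\<close>; the hypotheses state this with
  \<open>q\<close> eliminated. A bit arrives intact if the other transmitter is silent
  there.\<close>

lemma level_bit_received_isolated:
  assumes blocks: "xs1 \<in> blocks q k" "xs2 \<in> blocks q k" and le: "g i 1 \<le> q" "g i 2 \<le> q"
  shows level_bit_received_isolated_left:
      "p < k * g i 1 \<Longrightarrow>
        (\<And>p'. p' < k * g i 2 \<Longrightarrow> p + k * g i 2 = p' + k * g i 1 \<Longrightarrow> level_bit k xs2 p' = 0) \<Longrightarrow>
        level_bit k (received_block q g i xs1 xs2) (p + k * (q - g i 1)) = level_bit k xs1 p"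
    and level_bit_received_isolated_right:
      "p < k * g i 2 \<Longrightarrow>
        (\<And>p'. p' < k * g i 1 \<Longrightarrow> p' + k * g i 2 = p + k * g i 1 \<Longrightarrow> level_bit k xs1 p' = 0) \<Longrightarrow>
        level_bit k (received_block q g i xs1 xs2) (p + k * (q - g i 2)) = level_bit k xs2 p"
proof -
  have shift: "k * (q - h) + k * h = k * q" if "h \<le> q" for h
    using that by (simp flip: distrib_left)
  note shifts = shift[OF le(1)] shift[OF le(2)]
  {
    assume p: "p < k * g i 1"
      and zero: "\<And>p'. p' < k * g i 2 \<Longrightarrow> p + k * g i 2 = p' + k * g i 1 \<Longrightarrow> level_bit k xs2 p' = 0"
    have "p + k * (q - g i 1) < k * q"
      using p shifts by linarith
    moreover have "delay (k * (q - g i 2)) (level_bit k xs2) (p + k * (q - g i 1)) = 0"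
    proof (cases "k * (q - g i 2) \<le> p + k * (q - g i 1)")
      case True
      have "level_bit k xs2 (p + k * (q - g i 1) - k * (q - g i 2)) = 0"
        by (rule zero) (use p shifts True in linarith)+
      then show ?thesis
        using True by (simp add: delay_def)
    qed (simp add: delay_def)
    ultimately show "level_bit k (received_block q g i xs1 xs2) (p + k * (q - g i 1)) = level_bit k xs1 p"
      using blocks by (simp add: level_bit_received_block) (simp add: delay_def)
  next
    assume p: "p < k * g i 2"
      and zero: "\<And>p'. p' < k * g i 1 \<Longrightarrow> p' + k * g i 2 = p + k * g i 1 \<Longrightarrow> level_bit k xs1 p' = 0"
    have "p + k * (q - g i 2) < k * q"
      using p shifts by linarith
    moreover have "delay (k * (q - g i 1)) (level_bit k xs1) (p + k * (q - g i 2)) = 0"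
    proof (cases "k * (q - g i 1) \<le> p + k * (q - g i 2)")
      case True
      have "level_bit k xs1 (p + k * (q - g i 2) - k * (q - g i 1)) = 0"
        by (rule zero) (use p shifts True in linarith)+
      then show ?thesis
        using True by (simp add: delay_def)
    qed (simp add: delay_def)
    ultimately show "level_bit k (received_block q g i xs1 xs2) (p + k * (q - g i 2)) = level_bit k xs2 p"
      using blocks by (simp add: level_bit_received_block) (simp add: delay_def)
  }
qed

text \<open>Codes use natural numbers as messages, whereas routing uses assignments of bits to
  levels; bijections onto initial segments translate between them.\<close>

lemma zero_error_code_exists:
  fixes M1 :: "'a set" and M2 :: "'b set"
  assumes M: "finite M1" "finite M2" "M1 \<noteq> {}" "M2 \<noteq> {}"
    and E: "E1 \<in> M1 \<rightarrow> blocks q k" "E2 \<in> M2 \<rightarrow> blocks q k"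
    and R: "R1 \<in> blocks q k \<rightarrow> blocks q k" "R2 \<in> blocks q k \<rightarrow> blocks q k"
    and D: "D1 \<in> blocks q k \<rightarrow> M1" "D2 \<in> blocks q k \<rightarrow> M2"
    and relays: "\<And>x y i. U i x y = (if i = 1 then R1 else R2) (received_block q m i (E1 x) (E2 y))"
    and decode: "\<And>x y. x \<in> M1 \<Longrightarrow> y \<in> M2 \<Longrightarrow> D1 (received_block q n 1 (U 1 x y) (U 2 x y)) = x"
      "\<And>x y. x \<in> M1 \<Longrightarrow> y \<in> M2 \<Longrightarrow> D2 (received_block q n 2 (U 1 x y) (U 2 x y)) = y"
  shows "\<exists>c. is_code q k c \<and> card (messages c 1) = card M1 \<and> card (messages c 2) = card M2 \<and>
    error_prob q m n c = 0"
proof -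
  obtain h1 where h1: "bij_betw h1 M1 {0..<card M1}"
    using ex_bij_betw_finite_nat[OF M(1)] by blast
  obtain h2 where h2: "bij_betw h2 M2 {0..<card M2}"
    using ex_bij_betw_finite_nat[OF M(2)] by blast
  define g1 g2 where "g1 = inv_into M1 h1" and "g2 = inv_into M2 h2"
  have g1: "g1 w \<in> M1" "h1 (g1 w) = w" if "w < card M1" for w
    using bij_betw_inv_into[OF h1] bij_betw_inv_into_right[OF h1] that
    by (auto simp: g1_def bij_betw_def)
  have g2: "g2 w \<in> M2" "h2 (g2 w) = w" if "w < card M2" for w
    using bij_betw_inv_into[OF h2] bij_betw_inv_into_right[OF h2] that
    by (auto simp: g2_def bij_betw_def)
  have h: "x \<in> M1 \<Longrightarrow> h1 x < card M1" "y \<in> M2 \<Longrightarrow> h2 y < card M2" for x y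
    using h1 h2 by (auto simp: bij_betw_def)
  define c where "c = \<lparr>messages = \<lambda>i. if i = 1 then {0..<card M1} else {0..<card M2},
      encoder = \<lambda>i w. if i = 1 then E1 (g1 w) else E2 (g2 w),
      relay_map = \<lambda>i. if i = 1 then R1 else R2,
      decoder = \<lambda>i ys. if i = 1 then h1 (D1 ys) else h2 (D2 ys)\<rparr>"
  have sel: "messages c 1 = {0..<card M1}" "messages c 2 = {0..<card M2}"
    "encoder c 1 w = E1 (g1 w)" "encoder c 2 w = E2 (g2 w)"
    "relay_map c i = (if i = 1 then R1 else R2)"
    "decoder c 1 ys = h1 (D1 ys)" "decoder c 2 ys = h2 (D2 ys)" for w i ys
    by (simp_all add: c_def)
  have card_pos: "card M1 > 0" "card M2 > 0"
    using M by (simp_all add: card_gt_0_iff)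
  have "is_code q k c"
    using E R D g1 g2 h card_pos by (auto simp: is_code_def sel Pi_iff)
  moreover have "error_prob q m n c = 0"
  proof -
    have "(decoded q m n c 1 w, decoded q m n c 2 w) = w" if "w \<in> messages c 1 \<times> messages c 2" for w
    proof -
      have w: "fst w < card M1" "snd w < card M2"
        using that by (auto simp: sel)
      have "relay_block q m c i w = U i (g1 (fst w)) (g2 (snd w))" for i
        by (simp add: relay_block_def sel relays)
      then show ?thesis
        using w by (simp add: decoded_def sel decode g1 g2)
    qed
    moreover have "set_pmf (pair_pmf (pmf_of_set (messages c 1)) (pmf_of_set (messages c 2))) =
        messages c 1 \<times> messages c 2"
      using card_pos by (simp add: sel set_pmf_of_set)
    ultimately show ?thesis
      unfolding error_prob_def measure_pmf_zero_iff by blast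
  qed
  ultimately show ?thesis
    by (intro exI[of _ c]) (simp add: sel)
qed

text \<open>Levels are counted at the receiver where the links of gains \<open>b\<close> and \<open>c\<close> meet, so that
  a collision is a common element; \<open>a\<close> is the gain of the remaining link.\<close>

lemma interleaved_levels:
  fixes a b c r k1 k2 :: nat
  assumes "r \<le> a" "k1 \<le> b" "k2 \<le> c" "k1 + k2 \<le> max b c" "r + k1 \<le> max a b"
    "r + k1 + k2 \<le> max a b + (c - b)"
  defines "M \<equiv> max b c"
  obtains A B G where "A \<subseteq> {M - b..<M - b + a}" "B \<subseteq> {M - b..<M}" "G \<subseteq> {M - c..<M}"
    "card A = r" "card B = k1" "card G = k2" "A \<inter> B = {}" "(A \<union> B) \<inter> G = {}"
proof -
  \<comment> \<open>Up to \<open>a - b\<close> bits of \<open>A\<close> go to positions from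
    \<open>M\<close> on, which the meeting receiver cannot hear. The other \<open>r'\<close> bits
    are heard and take the top positions of their link.\<close>
  define r' where "r' = r - (a - b)"
  define A where "A = {M - b..<M - b + r'} \<union> {M..<M + (r - r')}"
  have r': "r' \<le> b" "r' \<le> r" "r - r' \<le> a - b" "r' + k1 \<le> b" "r' + k1 + k2 \<le> M"
    using assms(1,2,4-6) by (auto simp: r'_def M_def)
  have "b \<le> M"
    by (simp add: M_def)
  \<comment> \<open>If \<open>r' = r\<close>, the part of \<open>A\<close> from \<open>M\<close> on
    is empty; otherwise \<open>b < a\<close>, and it fits.\<close>
  then have "M + (r - r') \<le> M - b + a" if "r' < r"
    using r'(3) that by linarith
  then have A: "A \<subseteq> {M - b..<M - b + a}" "finite A"
    using r' assms(1) by (auto simp: A_def)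
  have "card A = r' + (r - r')"
    unfolding A_def using r' by (subst card_Un_disjoint) (auto simp: M_def)
  then have "card A = r"
    using r' by simp
  \<comment> \<open>Once \<open>A\<close> and one further set are placed, the third set may take any
    free positions, and counting shows that enough are left.\<close>
  have rest: "\<exists>S\<subseteq>{0..<M} - (A \<union> T). card S = s"
    if T: "T \<subseteq> {0..<M}" "card T = t" and s: "r' + t + s \<le> M" for T s t
  proof -
    have fin: "finite T"
      using T(1) by (rule finite_subset) simp
    have "card ({M - b..<M - b + r'} \<union> T) \<le> r' + t"
      using card_Un_le[of "{M - b..<M - b + r'}" T] T(2) by simp
    moreover have "card {0..<M} - card ({M - b..<M - b + r'} \<union> T)
        \<le> card ({0..<M} - ({M - b..<M - b + r'} \<union> T))"
      using fin by (intro diff_card_le_card_Diff) simp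
    moreover have "{0..<M} - (A \<union> T) = {0..<M} - ({M - b..<M - b + r'} \<union> T)"
      by (auto simp: A_def)
    ultimately have "s \<le> card ({0..<M} - (A \<union> T))"
      using s by simp
    then obtain S where "S \<subseteq> {0..<M} - (A \<union> T)" "card S = s"
      by (rule obtain_subset_with_card_n)
    then show ?thesis
      by blast
  qed
  show thesis
  proof (cases "b \<le> c")
    case True
    \<comment> \<open>Here \<open>M = c\<close>, so \<open>G\<close> may lie anywhere below
      \<open>M\<close>. The more restricted \<open>B\<close> is placed first, at the bottom, clear
      of \<open>A\<close> at the top.\<close>
    let ?B = "{M - k1..<M}"
    obtain G where G: "G \<subseteq> {0..<M} - (A \<union> ?B)" "card G = k2"
      using rest[of ?B k1 k2] r' by auto
    show thesis
    proof (rule that[OF A(1)])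
      show "?B \<subseteq> {M - b..<M}"
        using diff_le_mono2[OF assms(2), of M] by auto
      show "A \<inter> ?B = {}"
        using r' by (auto simp: A_def)
      show "G \<subseteq> {M - c..<M}"
        using G True by (auto simp: M_def)
      show "card ?B = k1"
        using r' by simp
      show "(A \<union> ?B) \<inter> G = {}"
        using G by blast
    qed fact+
  next
    case False
    \<comment> \<open>Now \<open>M = b\<close> and \<open>B\<close> is the set that may lie anywhere
      below \<open>M\<close>.\<close>
    let ?G = "{M - k2..<M}"
    obtain B where B: "B \<subseteq> {0..<M} - (A \<union> ?G)" "card B = k1"
      using rest[of ?G k2 k1] r' by auto
    have "A \<inter> ?G = {}"
      using r' False by (auto simp: A_def M_def)
    show thesis
    proof (rule that[OF A(1)])
      show "B \<subseteq> {M - b..<M}"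
        using B False by (auto simp: M_def)
      show "?G \<subseteq> {M - c..<M}"
        using diff_le_mono2[OF assms(3), of M] by auto
      show "card ?G = k2"
        using r' by simp
      show "A \<inter> B = {}" "(A \<union> B) \<inter> ?G = {}"
        using B \<open>A \<inter> ?G = {}\<close> by blast+
    qed fact+
  qed
qed

text \<open>Translation from receiver positions back to transmitter levels. \<open>A\<close> and
  \<open>B\<close> are sent by the same relay and share the offset \<open>M - b\<close>;
  \<open>x + c = y + b\<close> is a collision at the receiver.\<close>

lemma second_stage_levels:
  fixes a b c r k1 k2 :: nat
  assumes "r \<le> a" "k1 \<le> b" "k2 \<le> c" "k1 + k2 \<le> max b c" "r + k1 \<le> max a b"
    "r + k1 + k2 \<le> max a b + (c - b)"
  obtains A B G where "A \<subseteq> {..<a}" "B \<subseteq> {..<b}" "G \<subseteq> {..<c}"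
    "card A = r" "card B = k1" "card G = k2" "A \<inter> B = {}"
    "\<And>x y. x \<in> A \<union> B \<Longrightarrow> y \<in> G \<Longrightarrow> x + c \<noteq> y + b"
proof -
  define M where "M = max b c"
  obtain A B G where sets: "A \<subseteq> {M - b..<M - b + a}" "B \<subseteq> {M - b..<M}" "G \<subseteq> {M - c..<M}"
    and card: "card A = r" "card B = k1" "card G = k2" and disj: "A \<inter> B = {}" "(A \<union> B) \<inter> G = {}"
    using interleaved_levels[OF assms] unfolding M_def by metis
  let ?f = "\<lambda>z. z - (M - b)" and ?g = "\<lambda>z. z - (M - c)"
  have ge: "M - b \<le> z" if "z \<in> A \<union> B" for z
    using that sets by auto
  have ge': "M - c \<le> z" if "z \<in> G" for z
    using that sets by auto
  have inj: "inj_on ?f (A \<union> B)" "inj_on ?g G"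
    by (rule inj_on_diff_nat, fact ge ge')+
  show thesis
  proof (rule that[of "?f ` A" "?f ` B" "?g ` G"])
    show "?f ` A \<subseteq> {..<a}" "?f ` B \<subseteq> {..<b}" "?g ` G \<subseteq> {..<c}"
      using sets by (fastforce simp: M_def)+
    show "card (?f ` A) = r" "card (?f ` B) = k1" "card (?g ` G) = k2"
      using inj card by (auto simp: card_image inj_on_Un)
    show "?f ` A \<inter> ?f ` B = {}"
      using inj_on_image_Int[OF inj(1), of A B] disj by simp
    show "x + c \<noteq> y + b" if xy: "x \<in> ?f ` A \<union> ?f ` B" "y \<in> ?g ` G" for x y
    proof
      assume eq: "x + c = y + b"
      obtain z z' where z: "z \<in> A \<union> B" "x = z - (M - b)" and z': "z' \<in> G" "y = z' - (M - c)"
        using xy by auto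
      have "z = M - b + x" "z' = M - c + y"
        using z z' ge ge' by simp_all
      moreover have "M - b + b = M - c + c"
        by (simp add: M_def)
      ultimately have "z = z'"
        using eq by linarith
      then show False
        using z(1) z'(1) disj by blast
    qed
  qed
qed

text \<open>Turning the levels of all signals upside down exchanges the roles of transmitters and
  receivers, so that the first stage is a mirror image of the second.\<close>

lemma first_stage_levels:
  fixes a b c r k1 k2 :: nat
  assumes "r \<le> a" "k1 \<le> b" "k2 \<le> c" "k1 + k2 \<le> max b c" "r + k1 \<le> max a b"
    "r + k1 + k2 \<le> max a b + (c - b)"
  obtains A B G where "A \<subseteq> {..<a}" "B \<subseteq> {..<b}" "G \<subseteq> {..<c}"
    "card A = r" "card B = k1" "card G = k2" "B \<inter> G = {}"
    "\<And>x y. x \<in> A \<Longrightarrow> y \<in> B \<union> G \<Longrightarrow> x + b \<noteq> y + a"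
proof -
  obtain A B G where sets: "A \<subseteq> {..<a}" "B \<subseteq> {..<b}" "G \<subseteq> {..<c}"
    and card: "card A = r" "card B = k1" "card G = k2" and disj: "A \<inter> B = {}"
    and sep: "\<And>x y. x \<in> A \<union> B \<Longrightarrow> y \<in> G \<Longrightarrow> x + c \<noteq> y + b"
    using second_stage_levels[OF assms] by metis
  \<comment> \<open>This reverses the levels 0 to \<open>s - 1\<close>. A collision at the receiver
    becomes a shared transmitter level and vice versa.\<close>
  let ?f = "\<lambda>s z. s - Suc z"
  have inj: "inj_on (?f s) S" if "S \<subseteq> {..<s}" for s S
  proof (rule inj_onI)
    fix x y assume "x \<in> S" "y \<in> S" and eq: "s - Suc x = s - Suc y"
    then have "x < s" "y < s"
      using that by auto
    then show "x = y"
      using eq by linarith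
  qed
  show thesis
  proof (rule that[of "?f a ` A" "?f b ` B" "?f c ` G"])
    show "?f a ` A \<subseteq> {..<a}" "?f b ` B \<subseteq> {..<b}" "?f c ` G \<subseteq> {..<c}"
      using sets by fastforce+
    show "card (?f a ` A) = r" "card (?f b ` B) = k1" "card (?f c ` G) = k2"
      using card by (simp_all add: card_image inj sets)
    show "?f b ` B \<inter> ?f c ` G = {}"
    proof -
      have "b - Suc x \<noteq> c - Suc y" if "x \<in> B" "y \<in> G" for x y
      proof -
        have "x < b" "y < c" "x + c \<noteq> y + b"
          using sep[of x y] that sets by auto
        then show ?thesis
          by linarith
      qed
      then show ?thesis
        by blast
    qed
    show "x + b \<noteq> y + a" if xy: "x \<in> ?f a ` A" "y \<in> ?f b ` B \<union> ?f c ` G" for x y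
    proof -
      obtain x' where x': "x' \<in> A" "x = a - Suc x'" "x' < a"
        using xy(1) sets(1) by auto
      consider y' where "y' \<in> B" "y = b - Suc y'" "y' < b" | y' where "y' \<in> G" "y = c - Suc y'" "y' < c"
        using xy(2) sets(2,3) by (auto simp: subset_iff)
      then show ?thesis
      proof cases
        case 1
        then have "x' \<noteq> y'"
          using disj x' by blast
        then show ?thesis
          using 1 x' by simp
      next
        case 2
        then have "x' + c \<noteq> y' + b"
          using sep x' by simp
        then show ?thesis
          using 2 x' by simp
      qed
    qed
  qed
qed

text \<open>Elimination of \<open>k1\<close>: the hypotheses ensure that every lower bound on
  \<open>k1\<close> is at most every upper bound. In the application \<open>a b c\<close> are
  first-stage and \<open>d e f\<close> second-stage gains.\<close>

lemma split_second_rate: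
  fixes a b c d e f r s :: nat
  assumes "r \<le> a" "r \<le> d" "s \<le> max b c" "s \<le> max e f" "s \<le> b + f" "s \<le> c + e"
    "r + s \<le> max a b + f" "r + s \<le> c + max d e" "r + s \<le> max a b + (c - b)" "r + s \<le> max e f + (d - e)"
  obtains k1 k2 where "k1 + k2 = s" "k1 \<le> b" "k1 \<le> e" "k2 \<le> c" "k2 \<le> f" "r + k1 \<le> max a b" "r + k1 \<le> max d e"
proof
  \<comment> \<open>The least \<open>k1\<close> for which the remaining bits fit through both links
    of the second relay; the other conditions only bound \<open>k1\<close> from above.\<close>
  let ?k1 = "max (s - c) (s - f)"
  show "?k1 + (s - ?k1) = s" "?k1 \<le> b" "?k1 \<le> e" "s - ?k1 \<le> c" "s - ?k1 \<le> f"
    using assms by (auto simp: max_def split: if_splits)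
  show "r + ?k1 \<le> max a b" "r + ?k1 \<le> max d e"
    using assms by (auto simp: max_def split: if_splits)
qed

lemma routing_code_exists:
  fixes q k :: nat and m n :: "nat \<Rightarrow> nat \<Rightarrow> nat"
  assumes m_le: "\<And>i j. i \<in> {1, 2} \<Longrightarrow> j \<in> {1, 2} \<Longrightarrow> m i j \<le> q"
    and n_le: "\<And>i j. i \<in> {1, 2} \<Longrightarrow> j \<in> {1, 2} \<Longrightarrow> n i j \<le> q"
    and zs: "m 2 1 = 0" "n 1 2 = 0"
    and first: "A \<subseteq> {..<k * m 1 1}" "B \<subseteq> {..<k * m 1 2}" "G \<subseteq> {..<k * m 2 2}" "B \<inter> G = {}"
      "\<And>x y. x \<in> A \<Longrightarrow> y \<in> B \<union> G \<Longrightarrow> x + k * m 1 2 \<noteq> y + k * m 1 1"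
    and second: "A' \<subseteq> {..<k * n 1 1}" "B' \<subseteq> {..<k * n 2 1}" "G' \<subseteq> {..<k * n 2 2}" "A' \<inter> B' = {}"
      "\<And>x y. x \<in> A' \<union> B' \<Longrightarrow> y \<in> G' \<Longrightarrow> x + k * n 2 2 \<noteq> y + k * n 2 1"
    and card: "card A' = card A" "card B' = card B" "card G' = card G"
  shows "\<exists>c. is_code q k c \<and> card (messages c 1) = 2 ^ card A \<and>
    card (messages c 2) = 2 ^ (card B + card G) \<and> error_prob q m n c = 0"
proof -
  have finite: "finite A" "finite B" "finite G" "finite A'" "finite B'" "finite G'"
    using first(1-3) second(1-3) by (auto intro: finite_subset)
  have m: "m 1 1 \<le> q" "m 1 2 \<le> q" "m 2 1 \<le> q" "m 2 2 \<le> q"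
    and n: "n 1 1 \<le> q" "n 1 2 \<le> q" "n 2 1 \<le> q" "n 2 2 \<le> q"
    using m_le n_le by auto
  have below: "p < k * q" if "p < k * h" "h \<le> q" for p h
    using that by (meson le_trans mult_le_mono2 not_le)
  obtain fA fB fG where bij: "bij_betw fA A' A" "bij_betw fB B' B" "bij_betw fG G' G"
    using finite card by (metis finite_same_card_bij)
  define gA gB gG where "gA = inv_into A' fA" and "gB = inv_into B' fB" and "gG = inv_into G' fG"
  have gA: "gA p \<in> A'" "fA (gA p) = p" if "p \<in> A" for p
    using bij_betw_inv_into[OF bij(1)] bij_betw_inv_into_right[OF bij(1)] that
    by (auto simp: gA_def bij_betw_def)
  have gB: "gB p \<in> B'" "fB (gB p) = p" if "p \<in> B" for p
    using bij_betw_inv_into[OF bij(2)] bij_betw_inv_into_right[OF bij(2)] that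
    by (auto simp: gB_def bij_betw_def)
  have gG: "gG p \<in> G'" "fG (gG p) = p" if "p \<in> G" for p
    using bij_betw_inv_into[OF bij(3)] bij_betw_inv_into_right[OF bij(3)] that
    by (auto simp: gG_def bij_betw_def)
  have f: "p \<in> A' \<Longrightarrow> fA p \<in> A" "p \<in> B' \<Longrightarrow> fB p \<in> B" "p \<in> G' \<Longrightarrow> fG p \<in> G" for p
    using bij by (auto simp: bij_betw_def)
  define E1 E2 where "E1 = (\<lambda>x. of_levels q k (\<lambda>p. if p \<in> A then x p else 0))"
    and "E2 = (\<lambda>y. of_levels q k (\<lambda>p. if p \<in> B \<union> G then y p else 0))"
  \<comment> \<open>The arguments of \<open>level_bit\<close> are the receiver positions at which
    the source bits \<open>fA p\<close> and \<open>fB p\<close> arrive.\<close>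
  define R1 where "R1 = (\<lambda>zs. of_levels q k (\<lambda>p.
      if p \<in> A' then level_bit k zs (fA p + k * (q - m 1 1))
      else if p \<in> B' then level_bit k zs (fB p + k * (q - m 1 2)) else 0))"
  define R2 where "R2 = (\<lambda>zs. of_levels q k (\<lambda>p.
      if p \<in> G' then level_bit k zs (fG p + k * (q - m 2 2)) else 0))"
  define D1 where "D1 = (\<lambda>zs. \<lambda>p\<in>A. level_bit k zs (gA p + k * (q - n 1 1)))"
  define D2 where "D2 = (\<lambda>zs. \<lambda>p\<in>B \<union> G.
      if p \<in> B then level_bit k zs (gB p + k * (q - n 2 1)) else level_bit k zs (gG p + k * (q - n 2 2)))"
  define U where "U = (\<lambda>(i::nat) x y. (if i = 1 then R1 else R2) (received_block q m i (E1 x) (E2 y)))"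
  have E_blocks: "E1 x \<in> blocks q k" "E2 x \<in> blocks q k" for x
    by (simp_all add: E1_def E2_def)
  have U_blocks: "U i x y \<in> blocks q k" for i x y
    by (simp add: U_def R1_def R2_def)
  have E1: "level_bit k (E1 x) p = (if p \<in> A then x p else 0)" if "p < k * m i 1" "i \<in> {1, 2}" for x p i
    unfolding E1_def using below[OF that(1) m_le] that by simp
  have E2: "level_bit k (E2 y) p = (if p \<in> B \<union> G then y p else 0)" if "p < k * m i 2" "i \<in> {1, 2}" for y p i
    unfolding E2_def using below[OF that(1) m_le] that by simp
  have relay_in_A: "level_bit k (received_block q m 1 (E1 x) (E2 y)) (p + k * (q - m 1 1)) = x p" if "p \<in> A" for x y p
    by (subst level_bit_received_isolated_left)
      (use that first m E_blocks in \<open>auto simp: E1[where i = 1] E2[where i = 1]\<close>)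
  have relay_in_B: "level_bit k (received_block q m 1 (E1 x) (E2 y)) (p + k * (q - m 1 2)) = y p" if "p \<in> B" for x y p
    by (subst level_bit_received_isolated_right)
      (use that first m E_blocks in \<open>auto simp: E1[where i = 1] E2[where i = 1]\<close>)
  \<comment> \<open>As \<open>m 2 1 = 0\<close>, the first source has no level that could collide
    here.\<close>
  have relay_in_G: "level_bit k (received_block q m 2 (E1 x) (E2 y)) (p + k * (q - m 2 2)) = y p" if "p \<in> G" for x y p
    by (subst level_bit_received_isolated_right)
      (use that first m zs E_blocks in \<open>auto simp: E2[where i = 2]\<close>)
  have U1: "level_bit k (U 1 x y) p = (if p \<in> A' then x (fA p) else if p \<in> B' then y (fB p) else 0)"
    if "p < k * n i 1" "i \<in> {1, 2}" for x y p i
    using below[OF that(1) n_le] that f by (simp add: U_def R1_def relay_in_A relay_in_B)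
  have U2: "level_bit k (U 2 x y) p = (if p \<in> G' then y (fG p) else 0)"
    if "p < k * n i 2" "i \<in> {1, 2}" for x y p i
    using below[OF that(1) n_le] that f by (simp add: U_def R2_def relay_in_G)
  have dest_in_A: "level_bit k (received_block q n 1 (U 1 x y) (U 2 x y)) (p + k * (q - n 1 1)) = x (fA p)"
    if "p \<in> A'" for x y p
    by (subst level_bit_received_isolated_left)
      (use that second n zs U_blocks in \<open>auto simp: U1[where i = 1]\<close>)
  have dest_in_B: "level_bit k (received_block q n 2 (U 1 x y) (U 2 x y)) (p + k * (q - n 2 1)) = y (fB p)"
    if "p \<in> B'" for x y p
  proof -
    \<comment> \<open>\<open>R1\<close> tests for \<open>A'\<close> first, so disjointness of
      \<open>A'\<close> and \<open>B'\<close> lets the bits of \<open>B'\<close> through.\<close>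
    have "p < k * n 2 1" "p \<notin> A'"
      using that second by auto
    then show ?thesis
      by (subst level_bit_received_isolated_left)
        (use that second n U_blocks in \<open>auto simp: U1[where i = 2] U2[where i = 2]\<close>)
  qed
  have dest_in_G: "level_bit k (received_block q n 2 (U 1 x y) (U 2 x y)) (p + k * (q - n 2 2)) = y (fG p)"
    if "p \<in> G'" for x y p
    by (subst level_bit_received_isolated_right)
      (use that second n U_blocks in \<open>auto simp: U1[where i = 2] U2[where i = 2]\<close>)
  \<comment> \<open>Messages are extensional functions, so each bit pattern on the used levels is
    counted once.\<close>
  let ?M1 = "A \<rightarrow>\<^sub>E (UNIV :: bit set)" and ?M2 = "B \<union> G \<rightarrow>\<^sub>E (UNIV :: bit set)"
  have decode1: "D1 (received_block q n 1 (U 1 x y) (U 2 x y)) = x" if "x \<in> ?M1" for x y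
  proof
    fix p
    show "D1 (received_block q n 1 (U 1 x y) (U 2 x y)) p = x p"
      using that by (cases "p \<in> A") (simp_all add: D1_def dest_in_A gA PiE_arb[OF that])
  qed
  have decode2: "D2 (received_block q n 2 (U 1 x y) (U 2 x y)) = y" if "y \<in> ?M2" for x y
  proof
    fix p
    show "D2 (received_block q n 2 (U 1 x y) (U 2 x y)) p = y p"
      using that by (cases "p \<in> B \<union> G") (auto simp: D2_def dest_in_B dest_in_G gB gG PiE_arb[OF that])
  qed
  have "\<exists>c. is_code q k c \<and> card (messages c 1) = card ?M1 \<and> card (messages c 2) = card ?M2 \<and>
    error_prob q m n c = 0"
  proof (rule zero_error_code_exists[where U = U and ?R1.0 = R1 and ?R2.0 = R2 and ?D1.0 = D1 and ?D2.0 = D2])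
    show "finite ?M1" "finite ?M2"
      using finite finite_UNIV_bit by (auto intro!: finite_PiE)
    show "?M1 \<noteq> {}" "?M2 \<noteq> {}"
      by (auto simp: PiE_eq_empty_iff)
    show "E1 \<in> ?M1 \<rightarrow> blocks q k" "E2 \<in> ?M2 \<rightarrow> blocks q k"
      using E_blocks by auto
    show "R1 \<in> blocks q k \<rightarrow> blocks q k" "R2 \<in> blocks q k \<rightarrow> blocks q k"
      by (auto simp: R1_def R2_def)
    show "D1 \<in> blocks q k \<rightarrow> ?M1" "D2 \<in> blocks q k \<rightarrow> ?M2"
      by (auto simp: D1_def D2_def)
  qed (simp_all add: U_def[symmetric] decode1 decode2, simp add: U_def)
  moreover have "card ?M1 = 2 ^ card A" "card ?M2 = 2 ^ (card B + card G)"
    using finite first(4) by (simp_all add: card_PiE card_UNIV_bit card_Un_disjoint)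
  ultimately show ?thesis
    by simp
qed

lemma real_nat_diff: "real (a - b) = max (real a - real b) 0"
  by (simp add: max_def of_nat_diff)

lemma achievable_integer_rates:
  fixes q k s1 s2 :: nat and m n :: "nat \<Rightarrow> nat \<Rightarrow> nat"
  assumes "\<And>i j. i \<in> {1, 2} \<Longrightarrow> j \<in> {1, 2} \<Longrightarrow> m i j \<le> q"
    and "\<And>i j. i \<in> {1, 2} \<Longrightarrow> j \<in> {1, 2} \<Longrightarrow> n i j \<le> q"
    and "m 2 1 = 0" "n 1 2 = 0"
    and "s1 \<le> k * m 1 1" "s1 \<le> k * n 1 1"
      "s2 \<le> k * max (m 1 2) (m 2 2)" "s2 \<le> k * max (n 2 1) (n 2 2)"
      "s2 \<le> k * (m 1 2 + n 2 2)" "s2 \<le> k * (m 2 2 + n 2 1)"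
      "s1 + s2 \<le> k * (max (m 1 1) (m 1 2) + n 2 2)" "s1 + s2 \<le> k * (m 2 2 + max (n 1 1) (n 2 1))"
      "s1 + s2 \<le> k * (max (m 1 1) (m 1 2) + (m 2 2 - m 1 2))"
      "s1 + s2 \<le> k * (max (n 2 1) (n 2 2) + (n 1 1 - n 2 1))"
  shows "\<exists>c. is_code q k c \<and> card (messages c 1) = 2 ^ s1 \<and> card (messages c 2) = 2 ^ s2 \<and>
    error_prob q m n c = 0"
proof -
  \<comment> \<open>These are the ten bounds for the single-use network with all gains multiplied by
    \<open>k\<close>.\<close>
  have bounds: "s1 \<le> k * m 1 1" "s1 \<le> k * n 1 1"
    "s2 \<le> max (k * m 1 2) (k * m 2 2)" "s2 \<le> max (k * n 2 1) (k * n 2 2)"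
    "s2 \<le> k * m 1 2 + k * n 2 2" "s2 \<le> k * m 2 2 + k * n 2 1"
    "s1 + s2 \<le> max (k * m 1 1) (k * m 1 2) + k * n 2 2"
    "s1 + s2 \<le> k * m 2 2 + max (k * n 1 1) (k * n 2 1)"
    "s1 + s2 \<le> max (k * m 1 1) (k * m 1 2) + (k * m 2 2 - k * m 1 2)"
    "s1 + s2 \<le> max (k * n 2 1) (k * n 2 2) + (k * n 1 1 - k * n 2 1)"
    using assms(5-14) by (simp_all only: distrib_left nat_mult_max_right diff_mult_distrib2)
  obtain k1 k2 where k: "k1 + k2 = s2" "k1 \<le> k * m 1 2" "k1 \<le> k * n 2 1" "k2 \<le> k * m 2 2" "k2 \<le> k * n 2 2"
    "s1 + k1 \<le> max (k * m 1 1) (k * m 1 2)" "s1 + k1 \<le> max (k * n 1 1) (k * n 2 1)"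
    using split_second_rate[OF bounds] by blast
  have first: "k1 + k2 \<le> max (k * m 1 2) (k * m 2 2)"
    "s1 + k1 + k2 \<le> max (k * m 1 1) (k * m 1 2) + (k * m 2 2 - k * m 1 2)"
    using bounds(3,9) k(1) by linarith+
  \<comment> \<open>The tenth bound appears with outer gains exchanged: both right-hand sides equal
    \<open>y + (x - y) + (z - y)\<close>, where \<open>y\<close> is the scaled gain
    \<open>n 2 1\<close> and \<open>x\<close>, \<open>z\<close> are the scaled gains
    \<open>n 1 1\<close>, \<open>n 2 2\<close>.\<close>
  have second: "k1 + k2 \<le> max (k * n 2 1) (k * n 2 2)"
    "s1 + k1 + k2 \<le> max (k * n 1 1) (k * n 2 1) + (k * n 2 2 - k * n 2 1)"
    using bounds(4,10) k(1) by linarith+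
  obtain A B G where fst: "A \<subseteq> {..<k * m 1 1}" "B \<subseteq> {..<k * m 1 2}" "G \<subseteq> {..<k * m 2 2}"
    "card A = s1" "card B = k1" "card G = k2" "B \<inter> G = {}"
    "\<And>x y. x \<in> A \<Longrightarrow> y \<in> B \<union> G \<Longrightarrow> x + k * m 1 2 \<noteq> y + k * m 1 1"
    using first_stage_levels[OF bounds(1) k(2,4) first(1) k(6) first(2)] by metis
  obtain A' B' G' where snd: "A' \<subseteq> {..<k * n 1 1}" "B' \<subseteq> {..<k * n 2 1}" "G' \<subseteq> {..<k * n 2 2}"
    "card A' = s1" "card B' = k1" "card G' = k2" "A' \<inter> B' = {}"
    "\<And>x y. x \<in> A' \<union> B' \<Longrightarrow> y \<in> G' \<Longrightarrow> x + k * n 2 2 \<noteq> y + k * n 2 1"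
    using second_stage_levels[OF bounds(2) k(3,5) second(1) k(7) second(2)] by metis
  have "\<exists>c. is_code q k c \<and> card (messages c 1) = 2 ^ card A \<and>
    card (messages c 2) = 2 ^ (card B + card G) \<and> error_prob q m n c = 0"
    by (rule routing_code_exists[OF assms(1-4) fst(1-3,7,8) snd(1-3,7,8)])
      (simp_all add: fst(4-6) snd(4-6))
  then show ?thesis
    by (simp add: fst k)
qed

theorem theorem1:
  fixes q :: nat and m n :: "nat \<Rightarrow> nat \<Rightarrow> nat"
  assumes "q \<ge> 1"
    and "\<And>i j. i \<in> {1, 2} \<Longrightarrow> j \<in> {1, 2} \<Longrightarrow> m i j \<le> q"
    and "\<And>i j. i \<in> {1, 2} \<Longrightarrow> j \<in> {1, 2} \<Longrightarrow> n i j \<le> q"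
    and "m 2 1 = 0" and "n 1 2 = 0"
  shows "admissible_region q m n =
    {(r1, r2). 0 \<le> r1 \<and> 0 \<le> r2 \<and>
       r1 \<le> real (m 1 1) \<and>
       r1 \<le> real (n 1 1) \<and>
       r2 \<le> max (real (m 1 2)) (real (m 2 2)) \<and>
       r2 \<le> max (real (n 2 1)) (real (n 2 2)) \<and>
       r2 \<le> real (m 1 2) + real (n 2 2) \<and>
       r2 \<le> real (m 2 2) + real (n 2 1) \<and>
       r1 + r2 \<le> max (real (m 1 1)) (real (m 1 2)) + real (n 2 2) \<and>
       r1 + r2 \<le> real (m 2 2) + max (real (n 1 1)) (real (n 2 1)) \<and>
       r1 + r2 \<le> max (real (m 1 1)) (real (m 1 2)) + max (real (m 2 2) - real (m 1 2)) 0 \<and>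
       r1 + r2 \<le> max (real (n 2 1)) (real (n 2 2)) + max (real (n 1 1) - real (n 2 1)) 0}"
proof -
  have code: "zs_code q k m n c" if "is_code q k c" for k c
    using assms that by unfold_locales auto
  \<comment> \<open>Each bound is first written as \<open>real\<close> of a natural number;
    truncated subtraction encodes the positive part.\<close>
  have "admissible q m n r1 r2 \<longleftrightarrow> 0 \<le> r1 \<and> 0 \<le> r2 \<and>
      r1 \<le> real (m 1 1) \<and> r1 \<le> real (n 1 1) \<and>
      r2 \<le> real (max (m 1 2) (m 2 2)) \<and> r2 \<le> real (max (n 2 1) (n 2 2)) \<and>
      r2 \<le> real (m 1 2 + n 2 2) \<and> r2 \<le> real (m 2 2 + n 2 1) \<and>
      r1 + r2 \<le> real (max (m 1 1) (m 1 2) + n 2 2) \<and>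
      r1 + r2 \<le> real (m 2 2 + max (n 1 1) (n 2 1)) \<and>
      r1 + r2 \<le> real (max (m 1 1) (m 1 2) + (m 2 2 - m 1 2)) \<and>
      r1 + r2 \<le> real (max (n 2 1) (n 2 2) + (n 1 1 - n 2 1))" (is "_ \<longleftrightarrow> ?R r1 r2") for r1 r2
  proof
    assume adm: "admissible q m n r1 r2"
    have first: "r1 \<le> real N"
      if "\<And>k c. is_code q k c \<Longrightarrow> card (zs_code.correct q m n c) \<le> card (messages c 2) * 2 ^ (k * N)" for N
      by (rule single_rate_le[OF adm, where i = 1]) (auto intro: zs_code.first_rate_bound[OF code] that)
    have second: "r2 \<le> real N"
      if "\<And>k c. is_code q k c \<Longrightarrow> card (zs_code.correct q m n c) \<le> card (messages c 1) * 2 ^ (k * N)" for N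
      by (rule single_rate_le[OF adm, where i = 2]) (auto intro: zs_code.second_rate_bound[OF code] that)
    have sum: "r1 + r2 \<le> real N"
      if "\<And>k c. is_code q k c \<Longrightarrow> card (zs_code.correct q m n c) \<le> 2 ^ (k * N)" for N
      by (rule sum_rate_le[OF adm]) (rule zs_code.sum_rate_bound[OF code that])
    show "?R r1 r2"
    proof (intro conjI)
      show "0 \<le> r1" "0 \<le> r2"
        using adm by (simp_all add: admissible_def)
    qed (rule first[OF zs_code.cut_m11[OF code]] first[OF zs_code.cut_n11[OF code]]
        second[OF zs_code.cut_m12_m22[OF code]] second[OF zs_code.cut_n21_n22[OF code]]
        second[OF zs_code.cut_m12_n22[OF code]] second[OF zs_code.cut_m22_n21[OF code]]
        sum[OF zs_code.cut_m11_m12_n22[OF code]] sum[OF zs_code.cut_m22_n11_n21[OF code]]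
        sum[OF zs_code.cut_m11_m12_m22[OF code]] sum[OF zs_code.cut_n21_n22_n11[OF code]]; assumption)+
  next
    assume region: "?R r1 r2"
    have "\<forall>\<^sub>F k in sequentially. \<exists>c. is_code q k c \<and>
        real (card (messages c 1)) \<ge> 2 powr (real k * (r1 - \<epsilon>)) \<and>
        real (card (messages c 2)) \<ge> 2 powr (real k * (r2 - \<epsilon>)) \<and>
        error_prob q m n c \<le> \<epsilon>" if "\<epsilon> > 0" for \<epsilon> :: real
    proof -
      have "\<forall>\<^sub>F k in sequentially. 1 / \<epsilon> < real k"
        using filterlim_real_sequentially by (simp add: filterlim_at_top_dense)
      then show ?thesis
      proof eventually_elim
        case (elim k)
        then have "1 < real k * \<epsilon>"
          using \<open>\<epsilon> > 0\<close> by (simp add: field_simps)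
        \<comment> \<open>Rounding down loses less than one bit per block, which
          \<open>k * \<epsilon> > 1\<close> absorbs.\<close>
        define s1 s2 where "s1 = nat \<lfloor>real k * r1\<rfloor>" and "s2 = nat \<lfloor>real k * r2\<rfloor>"
        have "0 \<le> real k * r1" "0 \<le> real k * r2"
          using region by simp_all
        then have s: "real s1 \<le> real k * r1" "real k * r1 < real s1 + 1"
          "real s2 \<le> real k * r2" "real k * r2 < real s2 + 1"
          unfolding s1_def s2_def by linarith+
        have "s \<le> k * N" if "real s \<le> real k * r" "r \<le> real N" for s N r
        proof -
          have "real k * r \<le> real k * real N"
            using that by (intro mult_left_mono) simp_all
          then have "real s \<le> real (k * N)"
            using that by simp
          then show ?thesis
            by linarith
        qed
        note le = this
        have "real (s1 + s2) \<le> real k * (r1 + r2)"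
          using s by (simp add: distrib_left)
        note le_sum = le[OF this]
        have "\<exists>c. is_code q k c \<and> card (messages c 1) = 2 ^ s1 \<and> card (messages c 2) = 2 ^ s2 \<and>
            error_prob q m n c = 0"
          by (rule achievable_integer_rates[where m = m and n = n, OF assms(2) assms(3) assms(4) assms(5)])
            (use region in \<open>auto intro!: le[OF s(1)] le[OF s(3)] le_sum simp del: of_nat_add\<close>)
        then obtain c where c: "is_code q k c" "card (messages c 1) = 2 ^ s1"
          "card (messages c 2) = 2 ^ s2" "error_prob q m n c = 0"
          by blast
        have "2 powr (real k * (r - \<epsilon>)) \<le> real (2 ^ t)" if "real k * r < real t + 1" for r t
        proof -
          have "real k * (r - \<epsilon>) \<le> real t"
            using that \<open>1 < real k * \<epsilon>\<close> by (simp add: right_diff_distrib)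
          then have "2 powr (real k * (r - \<epsilon>)) \<le> 2 powr real t"
            by simp
          then show ?thesis
            by (simp add: powr_realpow)
        qed
        then show ?case
          using c s \<open>\<epsilon> > 0\<close> by (intro exI[of _ c]) simp
      qed
    qed
    then show "admissible q m n r1 r2"
      using region by (simp add: admissible_def)
  qed
  then show ?thesis
    by (simp add: admissible_region_def of_nat_max real_nat_diff)
qed

end
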